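(* Let $F$ be a field with $\operatorname{char}(F)\neq 2,3$, let $K/F$ be a quadratic étale extension with non-trivial Galois automorphism $\sigma$, and let $\mathcal{K}=(J,N,\sharp,T)$ be a hermitian cubic norm structure over $K/F$. Let $\mathcal{A}=K\oplus J$ as an $F$-vector space, equipped with the involution $\overline{(s,b)}:=(s^\sigma,b)$ for all $s\in K$, $b\in J$, and with multiplication $$(s,b)(t,c):=\bigl(st+T(b,c),\; sc+t^\sigma b+b\times c\bigr)$$ for all $s,t\in K$ and all $b,c\in J$. Then $\mathcal{A}$ is a structurable $F$-algebra of skew-dimension one. Moreover, if $T$ is non-degenerate, then $\mathcal{A}$ is a central simple structurable $F$-algebra.
   Context: **Conventions.** A quadratic étale extension $K/F$ is either a separable quadratic field extension or the split algebra $F\oplus F$ (with $\sigma$ the exchange map). For $t\in K$ write $t^\sigma=\sigma(t)$ and $t^{2\sigma}=(t^\sigma)^2$. $T$ is non-degenerate if $T(a,J)=0$ implies $a=0$. **Hermitian cubic norm structure.** A hermitian (non-unital) cubic norm structure over $K/F$ is a quadruple $\mathcal{K}=(J,N,\sharp,T)$, where $J$ is a left $K$-module, $N\colon J\to K$ is a non-zero map, $\sharp\colon J\to J$, $a\mapsto a^\sharp$, is a map, and $T\colon J\times J\to K$ is a hermitian form (biadditive, $T(sa,tb)=st^\sigma T(a,b)$ and $T(a,b)^\sigma=T(b,a)$), such that with $a\times b:=(a+b)^\sharp-a^\sharp-b^\sharp$, for all $t\in K$, $a,b\in J$: (i) $(ta)^\sharp=t^{2\sigma}a^\sharp$; (ii)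 $N(ta)=t^3N(a)$; (iii) $N(a+b)=N(a)+T(b,a^\sharp)+T(a,b^\sharp)+N(b)$; (iv) $a^{\sharp\sharp}=N(a)a$. **Structurable algebra.** A structurable algebra over $F$ is a unital, not necessarily commutative or associative, $F$-algebra $\mathcal{A}$ with an $F$-linear involution $x\mapsto\overline{x}$ (so $\overline{\overline{x}}=x$, $\overline{xy}=\overline{y}\,\overline{x}$) such that, with $V_{x,y}(z):=(x\overline{y})z+(z\overline{y})x-(z\overline{x})y$, one has $[V_{x,y},V_{z,w}]=V_{V_{x,y}(z),w}-V_{z,V_{y,x}(w)}$ for all $x,y,z,w\in\mathcal{A}$, where $[A,B]=AB-BA$. Let $\mathcal{H}=\{x:\overline{x}=x\}$ and $\mathcal{S}=\{x:\overline{x}=-x\}$; the skew-dimension is $\dim_F\mathcal{S}$. With $[x,y]=xy-yx$ and $[x,y,z]=(xy)z-x(yz)$, the center is $Z(\mathcal{A})=\{x\in\mathcal{H}\mid [x,\mathcal{A}]=[x,\mathcal{A},\mathcal{A}]=[\mathcal{A},x,\mathcal{A}]=[\mathcal{A},\mathcal{A},x]=0\}$; $\mathcal{A}$ is central if $Z(\mathcal{A})=F\cdot 1$. An ideal is an $F$-subspace $I$ with $I\mathcal{A}\subseteq I$, $\mathcal{A}I\subseteq I$, $\overline{I}=I$; $\mathcal{A}$ is simple if it has no proper non-trivial ideals.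
   Formalization: If T is degenerate, the map ♯ is additionally assumed to be quadratic over F (so a×b is F-bilinear); without this the multiplication on K⊕J need not be bilinear and the claim fails. Nothing is added for non-degenerate T. *)

theory Defs
  imports
    "HOL-Computational_Algebra.Computational_Algebra"
    "HOL-Library.Product_Plus"
begin

section \<open>Quadratic etale extensions\<close>

definition ring_hom_map :: "('a::comm_ring_1 \<Rightarrow> 'b::comm_ring_1) \<Rightarrow> bool" where
  "ring_hom_map \<phi> \<longleftrightarrow>
     \<phi> 1 = 1 \<and> (\<forall>x y. \<phi> (x + y) = \<phi> x + \<phi> y) \<and> (\<forall>x y. \<phi> (x * y) = \<phi> x * \<phi> y)"

text \<open>An extension \<open>K/F\<close> is given by its structure map \<open>\<phi> : F \<rightarrow> K\<close>. The ring \<open>K\<close> is only of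
  class \<^class>\<open>comm_ring_1\<close>, so as to cover the split algebra as well. For separability,
  the irreducible polynomial \<open>p\<close> below is, up to a scalar, the minimal polynomial of \<open>t\<close>.\<close>

definition separable_quadratic_field_extension ::
    "('f::field \<Rightarrow> 'k::comm_ring_1) \<Rightarrow> bool" where
  "separable_quadratic_field_extension \<phi> \<longleftrightarrow>
     ring_hom_map \<phi> \<and>
     (\<forall>t::'k. t \<noteq> 0 \<longrightarrow> (\<exists>u. t * u = 1)) \<and>
     vector_space.dim (\<lambda>x t. \<phi> x * t) UNIV = 2 \<and>
     (\<forall>t. \<exists>p. irreducible p \<and> poly (map_poly \<phi> p) t = 0 \<and> coprime p (pderiv p))"

definition nontrivial_automorphism_over ::
    "('f::field \<Rightarrow> 'k::comm_ring_1) \<Rightarrow> ('k \<Rightarrow> 'k) \<Rightarrow> bool" where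
  "nontrivial_automorphism_over \<phi> \<sigma> \<longleftrightarrow>
     ring_hom_map \<sigma> \<and> bij \<sigma> \<and> (\<forall>x. \<sigma> (\<phi> x) = \<phi> x) \<and> \<sigma> \<noteq> id"

text \<open>\<open>K\<close> is isomorphic to \<open>F \<oplus> F\<close> as an \<open>F\<close>-algebra, with coordinates \<open>\<pi>\<^sub>1\<close> and \<open>\<pi>\<^sub>2\<close>, in such
  a way that \<open>\<sigma>\<close> becomes the exchange map.\<close>

definition split_quadratic_extension ::
    "('f::field \<Rightarrow> 'k::comm_ring_1) \<Rightarrow> ('k \<Rightarrow> 'k) \<Rightarrow> bool" where
  "split_quadratic_extension \<phi> \<sigma> \<longleftrightarrow>
     (\<exists>\<pi>\<^sub>1 \<pi>\<^sub>2 :: 'k \<Rightarrow> 'f.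
        ring_hom_map \<pi>\<^sub>1 \<and> ring_hom_map \<pi>\<^sub>2 \<and> bij (\<lambda>t. (\<pi>\<^sub>1 t, \<pi>\<^sub>2 t)) \<and>
        (\<forall>x. \<pi>\<^sub>1 (\<phi> x) = x \<and> \<pi>\<^sub>2 (\<phi> x) = x) \<and>
        (\<forall>t. \<pi>\<^sub>1 (\<sigma> t) = \<pi>\<^sub>2 t \<and> \<pi>\<^sub>2 (\<sigma> t) = \<pi>\<^sub>1 t))"

definition quadratic_etale_extension ::
    "('f::field \<Rightarrow> 'k::comm_ring_1) \<Rightarrow> ('k \<Rightarrow> 'k) \<Rightarrow> bool" where
  "quadratic_etale_extension \<phi> \<sigma> \<longleftrightarrow>
     (separable_quadratic_field_extension \<phi> \<and> nontrivial_automorphism_over \<phi> \<sigma>) \<or>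
     split_quadratic_extension \<phi> \<sigma>"


section \<open>Hermitian cubic norm structures\<close>

definition hermitian_form ::
    "('k::comm_ring_1 \<Rightarrow> 'k) \<Rightarrow> ('k \<Rightarrow> 'j::ab_group_add \<Rightarrow> 'j) \<Rightarrow> ('j \<Rightarrow> 'j \<Rightarrow> 'k) \<Rightarrow> bool" where
  "hermitian_form \<sigma> smul T \<longleftrightarrow>
     (\<forall>a b c. T (a + b) c = T a c + T b c) \<and>
     (\<forall>a b c. T a (b + c) = T a b + T a c) \<and>
     (\<forall>s t a b. T (smul s a) (smul t b) = s * \<sigma> t * T a b) \<and>
     (\<forall>a b. \<sigma> (T a b) = T b a)"

definition nondegenerate :: "('j::ab_group_add \<Rightarrow> 'j \<Rightarrow> 'k::comm_ring_1) \<Rightarrow> bool" where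
  "nondegenerate T \<longleftrightarrow> (\<forall>a. (\<forall>b. T a b = 0) \<longrightarrow> a = 0)"

definition polar :: "('j::ab_group_add \<Rightarrow> 'j) \<Rightarrow> 'j \<Rightarrow> 'j \<Rightarrow> 'j" where
  "polar q a b = q (a + b) - q a - q b"

definition hermitian_cubic_norm_structure ::
    "('k::comm_ring_1 \<Rightarrow> 'k) \<Rightarrow> ('k \<Rightarrow> 'j::ab_group_add \<Rightarrow> 'j) \<Rightarrow> ('j \<Rightarrow> 'k) \<Rightarrow> ('j \<Rightarrow> 'j) \<Rightarrow>
      ('j \<Rightarrow> 'j \<Rightarrow> 'k) \<Rightarrow> bool" where
  "hermitian_cubic_norm_structure \<sigma> smul N sharp T \<longleftrightarrow>
     module smul \<and>
     (\<exists>a. N a \<noteq> 0) \<and>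
     hermitian_form \<sigma> smul T \<and>
     (\<forall>t a. sharp (smul t a) = smul ((\<sigma> t)\<^sup>2) (sharp a)) \<and>
     (\<forall>t a. N (smul t a) = t ^ 3 * N a) \<and>
     (\<forall>a b. N (a + b) = N a + T b (sharp a) + T a (sharp b) + N b) \<and>
     (\<forall>a. sharp (sharp a) = smul (N a) a)"

text \<open>The axioms above force \<open>sharp\<close> to be a quadratic map over \<open>F\<close> if \<open>T\<close> is non-degenerate, but
  not in general: for a quadratic field extension \<open>K/F\<close> and any involutory permutation \<open>h\<close> of \<open>K\<close>,
  they hold on \<open>J = K \<oplus> K\<close> with \<open>N (t, r) = t ^ 3\<close>, \<open>T (t, r) (t', r') = 3 * t * \<sigma> t'\<close>,
  \<open>sharp (t, r) = ((\<sigma> t)\<^sup>2, (\<sigma> t)\<^sup>2 * h (r / t))\<close> for \<open>t \<noteq> 0\<close> and \<open>sharp (0, r) = 0\<close>.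
  For degenerate \<open>T\<close> quadraticity is therefore a separate requirement; it is what makes the
  multiplication on \<open>K \<oplus> J\<close> bilinear over \<open>F\<close>.\<close>

definition quadratic_map :: "('f::field \<Rightarrow> 'j::ab_group_add \<Rightarrow> 'j) \<Rightarrow> ('j \<Rightarrow> 'j) \<Rightarrow> bool" where
  "quadratic_map scl q \<longleftrightarrow>
     (\<forall>x a. q (scl x a) = scl (x\<^sup>2) (q a)) \<and>
     (\<forall>a. Vector_Spaces.linear scl scl (polar q a)) \<and>
     (\<forall>b. Vector_Spaces.linear scl scl (\<lambda>a. polar q a b))"


section \<open>Structurable algebras\<close>

text \<open>A non-associative algebra with involution is given by its scalar multiplication, its
  multiplication, its unit and its involution on a type carrying the additive group.\<close>

definition structurable_V :: "('a::ab_group_add \<Rightarrow> 'a \<Rightarrow> 'a) \<Rightarrow> ('a \<Rightarrow> 'a) \<Rightarrow> 'a \<Rightarrow> 'a \<Rightarrow> 'a \<Rightarrow> 'a" where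
  "structurable_V mul bar x y z =
     mul (mul x (bar y)) z + mul (mul z (bar y)) x - mul (mul z (bar x)) y"

locale algebra_with_involution = vector_space scl
  for scl :: "'f::field \<Rightarrow> 'a::ab_group_add \<Rightarrow> 'a" +
  fixes mul :: "'a \<Rightarrow> 'a \<Rightarrow> 'a" and one :: 'a and bar :: "'a \<Rightarrow> 'a"
  assumes mul_linear_right: "Vector_Spaces.linear scl scl (mul x)"
    and mul_linear_left: "Vector_Spaces.linear scl scl (\<lambda>x. mul x y)"
    and mul_one_left: "mul one x = x"
    and mul_one_right: "mul x one = x"
    and bar_linear: "Vector_Spaces.linear scl scl bar"
    and bar_bar: "bar (bar x) = x"
    and bar_mul: "bar (mul x y) = mul (bar y) (bar x)"

locale structurable_algebra = algebra_with_involution +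
  assumes structurable_identity:
    "structurable_V mul bar x y (structurable_V mul bar z w u) -
     structurable_V mul bar z w (structurable_V mul bar x y u) =
     structurable_V mul bar (structurable_V mul bar x y z) w u -
     structurable_V mul bar z (structurable_V mul bar y x w) u"

definition skew_dimension ::
    "('f::field \<Rightarrow> 'a::ab_group_add \<Rightarrow> 'a) \<Rightarrow> ('a \<Rightarrow> 'a) \<Rightarrow> nat" where
  "skew_dimension scl bar = vector_space.dim scl {x. bar x = - x}"

definition commutator :: "('a::ab_group_add \<Rightarrow> 'a \<Rightarrow> 'a) \<Rightarrow> 'a \<Rightarrow> 'a \<Rightarrow> 'a" where
  "commutator mul x y = mul x y - mul y x"

definition associator :: "('a::ab_group_add \<Rightarrow> 'a \<Rightarrow> 'a) \<Rightarrow> 'a \<Rightarrow> 'a \<Rightarrow> 'a \<Rightarrow> 'a" where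
  "associator mul x y z = mul (mul x y) z - mul x (mul y z)"

definition algebra_center ::
    "('a::ab_group_add \<Rightarrow> 'a \<Rightarrow> 'a) \<Rightarrow> ('a \<Rightarrow> 'a) \<Rightarrow> 'a set" where
  "algebra_center mul bar =
     {x. bar x = x \<and>
         (\<forall>y. commutator mul x y = 0) \<and>
         (\<forall>y z. associator mul x y z = 0 \<and> associator mul y x z = 0 \<and> associator mul y z x = 0)}"

definition central_algebra ::
    "('f::field \<Rightarrow> 'a::ab_group_add \<Rightarrow> 'a) \<Rightarrow> ('a \<Rightarrow> 'a \<Rightarrow> 'a) \<Rightarrow> 'a \<Rightarrow> ('a \<Rightarrow> 'a) \<Rightarrow> bool" where
  "central_algebra scl mul one bar \<longleftrightarrow> algebra_center mul bar = range (\<lambda>x. scl x one)"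

definition involution_ideal ::
    "('f::field \<Rightarrow> 'a::ab_group_add \<Rightarrow> 'a) \<Rightarrow> ('a \<Rightarrow> 'a \<Rightarrow> 'a) \<Rightarrow> ('a \<Rightarrow> 'a) \<Rightarrow> 'a set \<Rightarrow> bool" where
  "involution_ideal scl mul bar I \<longleftrightarrow>
     module.subspace scl I \<and>
     (\<forall>x\<in>I. \<forall>y. mul x y \<in> I \<and> mul y x \<in> I) \<and>
     bar ` I = I"

definition simple_algebra ::
    "('f::field \<Rightarrow> 'a::ab_group_add \<Rightarrow> 'a) \<Rightarrow> ('a \<Rightarrow> 'a \<Rightarrow> 'a) \<Rightarrow> ('a \<Rightarrow> 'a) \<Rightarrow> bool" where
  "simple_algebra scl mul bar \<longleftrightarrow>
     (\<forall>I. involution_ideal scl mul bar I \<longrightarrow> I = {0} \<or> I = UNIV)"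


section \<open>The algebra on \<open>K \<oplus> J\<close>\<close>

definition KJ_scale ::
    "('f::field \<Rightarrow> 'k::comm_ring_1) \<Rightarrow> ('k \<Rightarrow> 'j::ab_group_add \<Rightarrow> 'j) \<Rightarrow> 'f \<Rightarrow> 'k \<times> 'j \<Rightarrow> 'k \<times> 'j" where
  "KJ_scale \<phi> smul x = (\<lambda>(s, b). (\<phi> x * s, smul (\<phi> x) b))"

definition KJ_bar :: "('k::comm_ring_1 \<Rightarrow> 'k) \<Rightarrow> 'k \<times> 'j::ab_group_add \<Rightarrow> 'k \<times> 'j" where
  "KJ_bar \<sigma> = (\<lambda>(s, b). (\<sigma> s, b))"

definition KJ_mul ::
    "('k::comm_ring_1 \<Rightarrow> 'k) \<Rightarrow> ('k \<Rightarrow> 'j::ab_group_add \<Rightarrow> 'j) \<Rightarrow> ('j \<Rightarrow> 'j) \<Rightarrow> ('j \<Rightarrow> 'j \<Rightarrow> 'k) \<Rightarrow>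
      'k \<times> 'j \<Rightarrow> 'k \<times> 'j \<Rightarrow> 'k \<times> 'j" where
  "KJ_mul \<sigma> smul sharp T = (\<lambda>(s, b) (t, c).
     (s * t + T b c, smul s c + smul (\<sigma> t) b + polar sharp b c))"

end

theory Submission
  imports Defs
begin

text \<open>
  Write \<open>L\<^sub>z\<close> for \<open>V\<^bsub>z,1\<^esub>\<close>. Three ideas carry the proof.

  First, the structurable identity in five variables follows from its instance
  \<open>[L\<^sub>z, V\<^bsub>x,y\<^esub>] = V\<^bsub>L\<^sub>z x,y\<^esub> - V\<^bsub>x,L\<^bsub>\<zeta>\<^esub> y\<^esub>\<close> with \<open>\<zeta> = bar z\<close>, because the operators \<open>L\<^sub>z\<close>
  generate a Lie algebra that contains all \<open>V\<^bsub>x,y\<^esub>\<close>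
  (\<open>structurable_identity_if_unit\<close>; this is where \<open>1/3\<close> enters). On \<open>K \<oplus> J\<close> the operators
  \<open>L\<^bsub>(p,0)\<^esub>\<close> are diagonal, so that their instance only compares weights. The instance for
  \<open>L\<^bsub>(0,a)\<^esub>\<close> has two kinds of terms of degree four in \<open>J\<close>, and they cancel by two identities,
  in which \<open>\<boxtimes>\<close> is the polarisation of the adjoint \<open>\<sharp>\<close>: the linearisation of \<open>a\<sharp>\<sharp> = N a \<cdot> a\<close>,
  which describes the products \<open>(a \<boxtimes> b) \<boxtimes> (c \<boxtimes> d)\<close>, and the linearisation of
  \<open>a \<boxtimes> (a\<sharp> \<boxtimes> b) = \<sigma> (N a) \<cdot> b + T b a \<cdot> a\<sharp>\<close>, which describes the products \<open>a \<boxtimes> ((b \<boxtimes> c) \<boxtimes> d)\<close>.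

  Second, if \<open>T\<close> is non-degenerate, then the second identity is dual to the first one with respect
  to \<open>T\<close>, but \<open>T\<close> may be degenerate. The argument of \<open>defect_eq_0\<close> covers all cases: the first
  identity alone gives the second one whenever \<open>b\<close> is of the form \<open>a \<boxtimes> x\<close>, also after
  linearisation, and an element \<open>c\<close> with \<open>N c\<close> invertible has \<open>c \<boxtimes> J = J\<close>. Replacing the
  arguments \<open>c\<close> one after the other by arbitrary ones proves the identity in general. Over the
  split algebra a value \<open>N a \<noteq> 0\<close> may be a zero divisor, but then it is a multiple of an
  idempotent \<open>e\<close>, and \<open>e \<cdot> a + \<sigma> e \<cdot> a\<sharp>\<close> has an invertible norm (\<open>regular_element\<close>).

  Third, both kinds of quadratic etale extensions have the form \<open>K = F \<oplus> F\<theta>\<close> with \<open>\<sigma> \<theta> = - \<theta>\<close>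
  and \<open>\<theta>\<^sup>2 \<in> F\<close> non-zero. All later arguments use only this description. The skew elements of
  \<open>K \<oplus> J\<close> are the multiples of \<open>(\<theta>, 0)\<close>. Multiplying by \<open>(\<theta>, 0)\<close> on the left and on the right gives
  different signs on \<open>J\<close>; hence the centre lies in \<open>K\<close>, and every ideal is the sum of its parts in
  \<open>K\<close> and in \<open>J\<close>. A non-zero part in \<open>K\<close> contains \<open>1\<close> because the trace form of \<open>K/F\<close> is
  non-degenerate, and a non-zero part in \<open>J\<close> yields one in \<open>K\<close> because \<open>T\<close> is non-degenerate.
\<close>

section \<open>The structurable identity and its instance at the unit\<close>

lemma sum_of_thirds:
  assumes "(3 :: 'f::field) \<noteq> 0"
  shows "inverse 3 + inverse 3 + inverse 3 = (1 :: 'f)"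
proof -
  have "inverse 3 + inverse 3 + inverse 3 = (inverse 3 * (1 + 1 + 1) :: 'f)"
    by (simp only: distrib_left mult_1_right)
  also have "\<dots> = 1"
    using assms by simp
  finally show ?thesis .
qed

context algebra_with_involution
begin

abbreviation V where "V \<equiv> structurable_V mul bar"

lemma mul_add_right: "mul x (y + z) = mul x y + mul x z"
  using mul_linear_right by (simp add: Vector_Spaces.linear_iff)

lemma mul_add_left: "mul (x + y) z = mul x z + mul y z"
  using mul_linear_left by (simp add: Vector_Spaces.linear_iff)

lemma mul_scale_right: "mul x (scl r y) = scl r (mul x y)"
  using mul_linear_right by (simp add: Vector_Spaces.linear_iff)

lemma mul_scale_left: "mul (scl r x) y = scl r (mul x y)"
  using mul_linear_left by (simp add: Vector_Spaces.linear_iff)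

lemma bar_add: "bar (x + y) = bar x + bar y"
  using bar_linear by (simp add: Vector_Spaces.linear_iff)

lemma bar_scale: "bar (scl r x) = scl r (bar x)"
  using bar_linear by (simp add: Vector_Spaces.linear_iff)

lemma bar_one: "bar one = one"
  by (metis bar_bar bar_mul mul_one_left)

lemma V_add:
  "V (x + x') y z = V x y z + V x' y z"
  "V x (y + y') z = V x y z + V x y' z"
  "V x y (z + z') = V x y z + V x y z'"
  by (simp_all add: structurable_V_def mul_add_left mul_add_right bar_add algebra_simps)

lemma V_diff:
  "V (x - x') y z = V x y z - V x' y z"
  "V x (y - y') z = V x y z - V x y' z"
  "V x y (z - z') = V x y z - V x y z'"
  using V_add(1)[of "x - x'" x' y z] V_add(2)[of x "y - y'" y' z] V_add(3)[of x y "z - z'" z']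
  by (simp_all add: eq_diff_eq)

lemma V_bar_one: "V (bar z) one = V one z"
  by (simp add: structurable_V_def fun_eq_iff mul_one_left mul_one_right bar_bar bar_one)

lemma V_one_one: "V z one one = z + z - bar z"
  by (simp add: structurable_V_def mul_one_left mul_one_right bar_one)

text \<open>Call \<open>(D, D')\<close> a derivation pair if \<open>[D, V\<^bsub>a,b\<^esub>] = V\<^bsub>D a,b\<^esub> - V\<^bsub>a,D' b\<^esub>\<close> for all \<open>a\<close> and \<open>b\<close>. By
  assumption every \<open>(V\<^bsub>p,1\<^esub>, V\<^bsub>1,p\<^esub>)\<close> is one, and such pairs are closed under differences and, up to
  a sign in the second component, under commutators. It remains to write \<open>V\<^bsub>x,y\<^esub>\<close> and \<open>V\<^bsub>y,x\<^esub>\<close> in terms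
  of these: the assumption with \<open>z = v\<close> and \<open>y = 1\<close> involves \<open>V\<^bsub>x,2 bar v - v\<^esub>\<close>, and
  \<open>v \<mapsto> 2 bar v - v\<close> is bijective if \<open>3\<close> is invertible.\<close>

lemma structurable_identity_if_unit:
  assumes three: "(3 :: 'f) \<noteq> 0"
    and id: "\<And>z x y u. V z one (V x y u) - V x y (V z one u) =
          V (V z one x) y u - V x (V (bar z) one y) u"
  shows "V x y (V z w u) - V z w (V x y u) = V (V x y z) w u - V z (V y x w) u"
proof -
  \<comment> \<open>the solution of \<open>2 bar v - v = y\<close>\<close>
  define v where "v = scl (inverse 3) (y + bar y + bar y)"
  have t3: "scl (inverse 3) a + scl (inverse 3) a + scl (inverse 3) a = a" for a
    by (simp only: scale_left_distrib[symmetric] sum_of_thirds[OF three] scale_one)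
  have y: "V (bar v) one one = y"
  proof -
    have "V (bar v) one one = scl (inverse 3) y + scl (inverse 3) y + scl (inverse 3) y"
      by (simp add: V_one_one v_def bar_scale bar_add bar_bar scale_right_distrib)
    then show ?thesis using t3 by simp
  qed
  have V_xy: "V x y =
     (\<lambda>a. V (V v one x) one a - (V v one (V x one a) - V x one (V v one a)))"
    using id[of v x one] y by (simp add: fun_eq_iff algebra_simps)
  have V_yx: "V y x =
     (\<lambda>a. V (bar (V v one x)) one a
        - (V (bar x) one (V (bar v) one a) - V (bar v) one (V (bar x) one a)))"
    using id[of "bar v" one x] y by (simp add: fun_eq_iff V_bar_one bar_bar algebra_simps)
  define derivation_pair where "derivation_pair D D' \<longleftrightarrow>
      (\<forall>a b. D (a - b) = D a - D b \<and> D (a + b) = D a + D b) \<and>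
      (\<forall>a b e. D (V a b e) = V a b (D e) + V (D a) b e - V a (D' b) e)" for D D'
  have pair_V: "derivation_pair (V p one) (V (bar p) one)" for p
    unfolding derivation_pair_def using id[of p] by (simp add: V_add V_diff algebra_simps)
  have pair_commutator: "derivation_pair (\<lambda>a. D (E a) - E (D a)) (\<lambda>a. E' (D' a) - D' (E' a))"
    if "derivation_pair D D'" "derivation_pair E E'" for D D' E E'
    using that unfolding derivation_pair_def by (simp add: V_add V_diff)
  have pair_diff: "derivation_pair (\<lambda>a. D a - E a) (\<lambda>a. D' a - E' a)" if "derivation_pair D D'" "derivation_pair E E'" for D D' E E'
    using that unfolding derivation_pair_def by (simp add: V_add V_diff)
  have "derivation_pair (V x y) (V y x)"
    unfolding V_xy V_yx by (intro pair_diff pair_commutator pair_V)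
  then have "V x y (V z w u) = V z w (V x y u) + V (V x y z) w u - V z (V y x w) u"
    unfolding derivation_pair_def by blast
  then show ?thesis
    by (simp add: algebra_simps)
qed

end

section \<open>Hermitian modules with a cross product\<close>

text \<open>The identities between \<open>T\<close> and \<open>\<boxtimes>\<close> from which everything else follows. The norm and the adjoint
  appear only through \<open>T a (a \<boxtimes> a) = 6 N a\<close> and \<open>a \<boxtimes> a = 2 a\<sharp>\<close>, so that the
  identities are multilinear and can be specialised without any division. The last axiom provides
  an element of invertible norm. As \<open>T\<close> may be degenerate, the identity for
  \<open>(a \<boxtimes> b) \<boxtimes> (c \<boxtimes> d)\<close> is required in \<open>J\<close> itself and not only after pairing with \<open>T\<close>.\<close>

locale hermitian_cross_module = module smul
  for smul :: "'k::comm_ring_1 \<Rightarrow> 'j::ab_group_add \<Rightarrow> 'j" (infixr \<open>\<cdot>\<close> 76) +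
  fixes \<sigma> :: "'k \<Rightarrow> 'k"
    and T :: "'j \<Rightarrow> 'j \<Rightarrow> 'k"
    and cross :: "'j \<Rightarrow> 'j \<Rightarrow> 'j" (infixl \<open>\<boxtimes>\<close> 78)
    and half third :: 'k
  assumes \<sigma>_add: "\<sigma> (x + y) = \<sigma> x + \<sigma> y"
    and \<sigma>_mult: "\<sigma> (x * y) = \<sigma> x * \<sigma> y"
    and \<sigma>_\<sigma>: "\<sigma> (\<sigma> x) = x"
    and T_add_left: "T (a + b) c = T a c + T b c"
    and T_scale_left: "T (s \<cdot> a) b = s * T a b"
    and \<sigma>_T: "\<sigma> (T a b) = T b a"
    and cross_commute: "a \<boxtimes> b = b \<boxtimes> a"
    and cross_add_left: "(a + b) \<boxtimes> c = a \<boxtimes> c + b \<boxtimes> c"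
    and cross_scale_left: "(s \<cdot> a) \<boxtimes> b = \<sigma> s \<cdot> (a \<boxtimes> b)"
    and T_cross_left_commute: "T a (b \<boxtimes> c) = T b (a \<boxtimes> c)"
    and cross_cross_cross:
      "(a \<boxtimes> b) \<boxtimes> (c \<boxtimes> d) + (a \<boxtimes> c) \<boxtimes> (b \<boxtimes> d) + (a \<boxtimes> d) \<boxtimes> (b \<boxtimes> c) =
       T a (b \<boxtimes> c) \<cdot> d + T a (b \<boxtimes> d) \<cdot> c + T a (c \<boxtimes> d) \<cdot> b + T b (c \<boxtimes> d) \<cdot> a"
    and half: "half + half = 1"
    and third: "third + third + third = 1"
    and regular: "\<exists>c m. m * T c (c \<boxtimes> c) = 1"
begin

lemma \<sigma>_minus: "\<sigma> (- x) = - \<sigma> x"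
  using \<sigma>_add[of x "- x"] \<sigma>_add[of 0 0] by (simp add: eq_neg_iff_add_eq_0 add.commute)

lemma \<sigma>_diff: "\<sigma> (x - y) = \<sigma> x - \<sigma> y"
  using \<sigma>_add[of x "- y"] by (simp add: \<sigma>_minus)

lemma \<sigma>_zero: "\<sigma> 0 = 0" using \<sigma>_add[of 0 0] by simp

lemma \<sigma>_one: "\<sigma> 1 = 1"
  using \<sigma>_mult[of "\<sigma> 1" 1] by (simp add: \<sigma>_\<sigma>)

lemma \<sigma>_two: "\<sigma> 2 = 2"
  using \<sigma>_add[of 1 1] by (simp add: \<sigma>_one)

lemma T_diff_left: "T (a - b) c = T a c - T b c"
  using T_add_left[of "a - b" b c] by simp

lemma T_add_right: "T a (b + c) = T a b + T a c"
  using arg_cong[OF T_add_left[of b c a], of \<sigma>] by (simp add: \<sigma>_add \<sigma>_T)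

lemma T_diff_right: "T a (b - c) = T a b - T a c"
  using arg_cong[OF T_diff_left[of b c a], of \<sigma>] by (simp add: \<sigma>_diff \<sigma>_T)

lemma T_scale_right: "T a (s \<cdot> b) = \<sigma> s * T a b"
  using arg_cong[OF T_scale_left[of s b a], of \<sigma>] by (simp add: \<sigma>_mult \<sigma>_T)

lemma T_zero: "T 0 a = 0" "T a 0 = 0"
  using T_diff_left[of 0 0 a] T_diff_right[of a 0 0] by simp_all

lemma cross_add_right: "a \<boxtimes> (b + c) = a \<boxtimes> b + a \<boxtimes> c"
  using cross_add_left[of b c a] by (simp only: cross_commute[of a])

lemma cross_diff_left: "(a - b) \<boxtimes> c = a \<boxtimes> c - b \<boxtimes> c"
  using cross_add_left[of "a - b" b c] by simp

lemma cross_diff_right: "a \<boxtimes> (b - c) = a \<boxtimes> b - a \<boxtimes> c"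
  using cross_diff_left[of b c a] by (simp only: cross_commute[of a])

lemma cross_scale_right: "a \<boxtimes> (s \<cdot> b) = \<sigma> s \<cdot> (a \<boxtimes> b)"
  using cross_scale_left[of s b a] by (simp only: cross_commute[of a])

lemma cross_zero: "0 \<boxtimes> a = 0" "a \<boxtimes> 0 = 0"
  using cross_diff_left[of 0 0 a] cross_diff_right[of a 0 0] by simp_all

lemma T_cross_left: "T (b \<boxtimes> c) a = T (a \<boxtimes> c) b"
  using arg_cong[OF T_cross_left_commute[of a b c], of \<sigma>] by (simp add: \<sigma>_T)

lemma T_cross_right: "T (b \<boxtimes> c) a = T (b \<boxtimes> a) c"
  using T_cross_left[of c b a] by (simp only: cross_commute[of _ b])

lemmas linear_simps = \<sigma>_add \<sigma>_mult \<sigma>_\<sigma> \<sigma>_diff \<sigma>_minus \<sigma>_zero \<sigma>_one \<sigma>_two \<sigma>_T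
  T_add_left T_add_right T_diff_left T_diff_right T_scale_left T_scale_right T_zero
  cross_add_left cross_add_right cross_diff_left cross_diff_right
  cross_scale_left cross_scale_right cross_zero
  scale_left_distrib scale_right_distrib scale_left_diff_distrib scale_right_diff_distrib scale_scale

lemma double_eq_0:
  assumes "a + a = (0::'j)"
  shows "a = 0"
proof -
  have "(half + half) \<cdot> a = half \<cdot> (a + a)"
    by (simp only: scale_left_distrib scale_right_distrib)
  then show ?thesis
    using assms by (simp only: half scale_one scale_zero_right)
qed

lemma triple_eq_0:
  assumes "a + a + a = (0::'j)"
  shows "a = 0"
proof -
  have "(third + third + third) \<cdot> a = third \<cdot> (a + a + a)"
    by (simp only: scale_left_distrib scale_right_distrib)
  then show ?thesis
    using assms by (simp only: third scale_one scale_zero_right)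
qed

text \<open>Up to the factor \<open>6\<close>, the cubic map \<open>a \<mapsto> defect a a a d\<close> is
  \<open>a \<boxtimes> (a\<sharp> \<boxtimes> d) - T d a \<cdot> a\<sharp> - \<sigma> (N a) \<cdot> d\<close>, and \<open>defect\<close> is its polarisation in \<open>a\<close>.\<close>

definition defect where
  "defect a b c d =
     a \<boxtimes> ((b \<boxtimes> c) \<boxtimes> d) + b \<boxtimes> ((a \<boxtimes> c) \<boxtimes> d) + c \<boxtimes> ((a \<boxtimes> b) \<boxtimes> d)
     - T d a \<cdot> (b \<boxtimes> c) - T d b \<cdot> (a \<boxtimes> c) - T d c \<cdot> (a \<boxtimes> b) - T (b \<boxtimes> c) a \<cdot> d"

text \<open>For \<open>a = b = c = d\<close> this says that the defect of \<open>a\<close> vanishes on \<open>a \<boxtimes> x\<close>, which holds since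
  \<open>a\<sharp> \<boxtimes> (a \<boxtimes> x)\<close> is known from \<open>cross_cross_cross\<close> and \<open>T (a \<boxtimes> x) a = \<sigma> (T x (a \<boxtimes> a))\<close>. The linearised
  statement is obtained likewise: for each of the four elements as outermost factor, the three
  terms with that factor combine by \<open>cross_cross_cross\<close>.\<close>

lemma defect_sum:
  "defect b c d (a \<boxtimes> x) + defect a c d (b \<boxtimes> x) + defect a b d (c \<boxtimes> x) + defect a b c (d \<boxtimes> x) = 0"
proof -
  have *: "a \<boxtimes> ((b \<boxtimes> c) \<boxtimes> (d \<boxtimes> x)) + a \<boxtimes> ((b \<boxtimes> d) \<boxtimes> (c \<boxtimes> x)) + a \<boxtimes> ((c \<boxtimes> d) \<boxtimes> (b \<boxtimes> x)) =
     T (b \<boxtimes> c) d \<cdot> (a \<boxtimes> x) + T (b \<boxtimes> c) x \<cdot> (a \<boxtimes> d) + T (b \<boxtimes> d) x \<cdot> (a \<boxtimes> c) + T (c \<boxtimes> d) x \<cdot> (a \<boxtimes> b)"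
    for a b c d
  proof -
    have "a \<boxtimes> ((b \<boxtimes> c) \<boxtimes> (d \<boxtimes> x)) + a \<boxtimes> ((b \<boxtimes> d) \<boxtimes> (c \<boxtimes> x)) + a \<boxtimes> ((c \<boxtimes> d) \<boxtimes> (b \<boxtimes> x)) =
      a \<boxtimes> (T b (c \<boxtimes> d) \<cdot> x + T b (c \<boxtimes> x) \<cdot> d + T b (d \<boxtimes> x) \<cdot> c + T c (d \<boxtimes> x) \<cdot> b)"
      unfolding cross_cross_cross[symmetric] cross_add_right
      by (simp only: cross_commute[of "d \<boxtimes> x"] cross_commute[of "c \<boxtimes> x"] cross_commute[of "b \<boxtimes> x"] add_ac)
    also have "\<dots> = T (b \<boxtimes> c) d \<cdot> (a \<boxtimes> x) + T (b \<boxtimes> c) x \<cdot> (a \<boxtimes> d) + T (b \<boxtimes> d) x \<cdot> (a \<boxtimes> c) + T (c \<boxtimes> d) x \<cdot> (a \<boxtimes> b)"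
      unfolding linear_simps
      by (simp add: T_cross_left T_cross_right cross_commute)
    finally show ?thesis .
  qed
  show ?thesis
    unfolding defect_def
    using *[of a b c d] *[of b a c d] *[of c a b d] *[of d a b c]
    by (simp add: algebra_simps cross_commute T_cross_left T_cross_right linear_simps)
qed

text \<open>With \<open>x = c \<boxtimes> c\<close> and \<open>n = T c x\<close>, \<open>cross_cross_cross\<close> gives \<open>3 (x \<boxtimes> x) = 4 n \<cdot> c\<close>. Therefore its
  instance at \<open>x, x, x, y\<close> turns, after cancelling \<open>\<sigma> (4 n / 3)\<close>, into
  \<open>3 c \<boxtimes> (x \<boxtimes> y) = \<sigma> n \<cdot> y + 3 T y c \<cdot> x\<close>, in which every term but \<open>\<sigma> n \<cdot> y\<close> visibly lies in
  \<open>c \<boxtimes> J\<close>.\<close>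

lemma cross_surjective:
  assumes "m * T c (c \<boxtimes> c) = 1"
  shows "\<exists>x. y = c \<boxtimes> x"
proof -
  define n where "n = T c (c \<boxtimes> c)"
  define k where "k = third * (n + n + n + n)"
  have mn: "m * n = 1" using assms by (simp add: n_def)
  \<comment> \<open>an inverse of \<open>k = 4 n / 3\<close>\<close>
  have "k * ((1 + 1 + 1) * (half * half * m)) =
      (third + third + third) * ((half + half) * (half + half)) * (m * n)"
    unfolding k_def by (simp only: distrib_left distrib_right mult_1_left mult_ac add_ac)
  then have "k * ((1 + 1 + 1) * (half * half * m)) = 1"
    by (simp only: mn half third mult_1_left)
  then have k_inv: "\<sigma> ((1 + 1 + 1) * (half * half * m)) * \<sigma> k = 1"
    by (simp only: \<sigma>_mult[symmetric] \<sigma>_one mult.commute)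
  have "(c \<boxtimes> c) \<boxtimes> (c \<boxtimes> c) = (third + third + third) \<cdot> ((c \<boxtimes> c) \<boxtimes> (c \<boxtimes> c))"
    by (simp only: third scale_one)
  also have "\<dots> = third \<cdot> ((c \<boxtimes> c) \<boxtimes> (c \<boxtimes> c) + (c \<boxtimes> c) \<boxtimes> (c \<boxtimes> c) + (c \<boxtimes> c) \<boxtimes> (c \<boxtimes> c))"
    by (simp only: scale_left_distrib scale_right_distrib)
  also have "\<dots> = k \<cdot> c"
    unfolding cross_cross_cross k_def n_def by (simp only: scale_left_distrib scale_right_distrib distrib_left scale_scale)
  finally have xx: "(c \<boxtimes> c) \<boxtimes> (c \<boxtimes> c) = k \<cdot> c" .
  define x where "x = c \<boxtimes> c"
  have xx: "x \<boxtimes> x = k \<cdot> c" using xx by (simp only: x_def)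
  have "T c x = n" by (simp only: n_def x_def)
  then have Txc: "T x c = \<sigma> n" using \<sigma>_T[of c x] by simp
  have Tx: "T x (x \<boxtimes> y) = T y (x \<boxtimes> x)"
    by (simp only: cross_commute[of x y] T_cross_left_commute[of x y x])
  have "(x \<boxtimes> x) \<boxtimes> (x \<boxtimes> y) + (x \<boxtimes> x) \<boxtimes> (x \<boxtimes> y) + (x \<boxtimes> x) \<boxtimes> (x \<boxtimes> y) =
      T x (x \<boxtimes> x) \<cdot> y + T y (x \<boxtimes> x) \<cdot> x + T y (x \<boxtimes> x) \<cdot> x + T y (x \<boxtimes> x) \<cdot> x"
    using cross_cross_cross[of x x x y] by (simp only: Tx cross_commute[of "x \<boxtimes> y"])
  then have "\<sigma> k \<cdot> (c \<boxtimes> (x \<boxtimes> y) + c \<boxtimes> (x \<boxtimes> y) + c \<boxtimes> (x \<boxtimes> y)) =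
      \<sigma> k \<cdot> (\<sigma> n \<cdot> y + T y c \<cdot> x + T y c \<cdot> x + T y c \<cdot> x)"
    by (simp only: xx cross_scale_left T_scale_right Txc scale_right_distrib scale_scale)
  then have "(\<sigma> ((1 + 1 + 1) * (half * half * m)) * \<sigma> k) \<cdot>
        (c \<boxtimes> (x \<boxtimes> y) + c \<boxtimes> (x \<boxtimes> y) + c \<boxtimes> (x \<boxtimes> y)) =
      (\<sigma> ((1 + 1 + 1) * (half * half * m)) * \<sigma> k) \<cdot>
        (\<sigma> n \<cdot> y + T y c \<cdot> x + T y c \<cdot> x + T y c \<cdot> x)"
    by (simp only: scale_scale[symmetric])
  then have triple: "c \<boxtimes> (x \<boxtimes> y) + c \<boxtimes> (x \<boxtimes> y) + c \<boxtimes> (x \<boxtimes> y) =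
      \<sigma> n \<cdot> y + T y c \<cdot> x + T y c \<cdot> x + T y c \<cdot> x"
    by (simp only: k_inv scale_one)
  define z where "z = x \<boxtimes> y - T c y \<cdot> c"
  have cz: "c \<boxtimes> z = c \<boxtimes> (x \<boxtimes> y) - T y c \<cdot> x"
    by (simp only: z_def cross_diff_right cross_scale_right \<sigma>_T x_def)
  have "c \<boxtimes> (z + z + z) = (c \<boxtimes> (x \<boxtimes> y) + c \<boxtimes> (x \<boxtimes> y) + c \<boxtimes> (x \<boxtimes> y))
      - (T y c \<cdot> x + T y c \<cdot> x + T y c \<cdot> x)"
    by (simp add: cross_add_right cz)
  then have "\<sigma> n \<cdot> y = c \<boxtimes> (z + z + z)"
    unfolding triple by simp
  then have "(\<sigma> m * \<sigma> n) \<cdot> y = c \<boxtimes> (m \<cdot> (z + z + z))"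
    by (simp only: cross_scale_right scale_scale[symmetric])
  moreover have "\<sigma> m * \<sigma> n = 1"
    by (simp only: \<sigma>_mult[symmetric] mn \<sigma>_one)
  ultimately show ?thesis by auto
qed

text \<open>Here \<open>defect_sum\<close> is applied to \<open>c, c, c, c\<close>, then to \<open>c, c, c, d\<close>, then to \<open>c, c, a, b\<close>, and finally to
  \<open>c, a, b, d\<close>, where \<open>c\<close> is the element of invertible norm. Every time, the terms that are not
  evaluated at a multiple \<open>c \<boxtimes> x\<close> vanish by the preceding step, and \<open>c \<boxtimes> x\<close> is arbitrary by
  \<open>cross_surjective\<close>.\<close>

lemma defect_eq_0: "defect a b d y = 0"
proof -
  obtain c m where c: "m * T c (c \<boxtimes> c) = 1" using regular by blast
  have 0: "defect c c c y = 0" for y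
  proof -
    obtain x where y: "y = c \<boxtimes> x" using cross_surjective[OF c] by blast
    have "(defect c c c y + defect c c c y) + (defect c c c y + defect c c c y) = 0"
      using defect_sum[of c c c c x] unfolding y by (simp only: add.assoc)
    then show ?thesis by (rule double_eq_0[OF double_eq_0])
  qed
  have 1: "defect c c d y = 0" for d y
  proof -
    obtain x where y: "y = c \<boxtimes> x" using cross_surjective[OF c] by blast
    have "defect c c d y + defect c c d y + defect c c d y = 0"
      using defect_sum[of c c d c x] unfolding y 0 by (simp only: add_0_right)
    then show ?thesis by (rule triple_eq_0)
  qed
  have 2: "defect c a b y = 0" for a b y
  proof -
    obtain x where y: "y = c \<boxtimes> x" using cross_surjective[OF c] by blast
    have "defect c a b y + defect c a b y = 0"
      using defect_sum[of c a b c x] unfolding y 1 by (simp only: add_0_right)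
    then show ?thesis by (rule double_eq_0)
  qed
  obtain x where y: "y = c \<boxtimes> x" using cross_surjective[OF c] by blast
  show ?thesis
    using defect_sum[of a b d c x] unfolding y 2 by (simp only: add_0_right)
qed

section \<open>The structurable identity for the algebra on \<open>K \<oplus> J\<close>\<close>

definition bar :: "'k \<times> 'j \<Rightarrow> 'k \<times> 'j" where
  "bar = (\<lambda>(s, b). (\<sigma> s, b))"

definition mul :: "'k \<times> 'j \<Rightarrow> 'k \<times> 'j \<Rightarrow> 'k \<times> 'j" where
  "mul = (\<lambda>(s, b) (t, c). (s * t + T b c, s \<cdot> c + \<sigma> t \<cdot> b + b \<boxtimes> c))"

abbreviation V where "V \<equiv> structurable_V mul bar"

lemma bar_eq: "bar (s, b) = (\<sigma> s, b)"
  by (simp add: bar_def)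

lemma mul_eq: "mul (s, b) (t, c) = (s * t + T b c, s \<cdot> c + \<sigma> t \<cdot> b + b \<boxtimes> c)"
  by (simp add: mul_def)

lemma V_eq:
  "V (s, b) (t, c) (r, d) =
    (r * s * \<sigma> t + r * s * \<sigma> t - r * \<sigma> s * t + s * T c d + t * T b d + r * T c b + T (b \<boxtimes> c) d,
     T b c \<cdot> d + T d c \<cdot> b - T d b \<cdot> c
       + (\<sigma> r * s) \<cdot> c + (\<sigma> r * t) \<cdot> b + (\<sigma> s * t) \<cdot> d
       + \<sigma> r \<cdot> (b \<boxtimes> c) + \<sigma> s \<cdot> (c \<boxtimes> d) + \<sigma> t \<cdot> (b \<boxtimes> d)
       + (b \<boxtimes> c) \<boxtimes> d + (d \<boxtimes> c) \<boxtimes> b - (d \<boxtimes> b) \<boxtimes> c)"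
  unfolding structurable_V_def mul_eq bar_eq
  by (simp add: linear_simps algebra_simps cross_commute T_cross_left T_cross_right)

lemma V_unit_eq:
  "V (s, b) (1, 0) (r, d) = ((s + s - \<sigma> s) * r + T b d, \<sigma> r \<cdot> b + \<sigma> s \<cdot> d + b \<boxtimes> d)"
  by (simp add: V_eq linear_simps algebra_simps)

text \<open>By \<open>V_unit_eq\<close>, \<open>V (p, 0) (1, 0)\<close> multiplies \<open>K\<close> by \<open>2 p - \<sigma> p\<close> and \<open>J\<close> by \<open>\<sigma> p\<close>. The identity holds
  because the weights agree for each term of \<open>V_eq\<close>.\<close>

lemma V_unit_scalar_identity:
  "V (p, 0) (1, 0) (V x y u) - V x y (V (p, 0) (1, 0) u) =
   V (V (p, 0) (1, 0) x) y u - V x (V (bar (p, 0)) (1, 0) y) u"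
proof (cases x, cases y, cases u)
  fix s b t c r d assume "x = (s, b)" "y = (t, c)" "u = (r, d)"
  then show ?thesis
    \<comment> \<open>sums \<open>s + s\<close> must not become \<open>2 * s\<close>, which would not distribute over scalars\<close>
    supply [[simproc del: int_combine_numerals]]
    by (simp add: V_unit_eq bar_eq) (simp add: V_eq linear_simps algebra_simps)
qed

text \<open>The terms that involve \<open>K\<close>-components cancel because \<open>T a (b \<boxtimes> c)\<close> is symmetric. In the \<open>J\<close>-component
  with \<open>b, c, d\<close> in place of \<open>x, y, u\<close>, the products \<open>p \<boxtimes> ((q \<boxtimes> r) \<boxtimes> s)\<close> with \<open>s = d, b, c\<close>
  respectively form three defects, and the products \<open>(p \<boxtimes> q) \<boxtimes> (r \<boxtimes> s)\<close> form one instance of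
  \<open>cross_cross_cross\<close>.\<close>

lemma V_unit_vector_identity:
  "V (0, a) (1, 0) (V x y u) - V x y (V (0, a) (1, 0) u) =
   V (V (0, a) (1, 0) x) y u - V x (V (bar (0, a)) (1, 0) y) u"
proof (cases x, cases y, cases u)
  fix s b t c r d assume eq: "x = (s, b)" "y = (t, c)" "u = (r, d)"
  have cross_right: "T e (f \<boxtimes> (g \<boxtimes> h)) = T (g \<boxtimes> h) (e \<boxtimes> f)" for e f g h
    by (subst cross_commute) (rule T_cross_left_commute)
  have cross_left: "T (e \<boxtimes> (f \<boxtimes> g)) h = T (e \<boxtimes> h) (f \<boxtimes> g)" for e f g h
    by (rule T_cross_right)
  \<comment> \<open>rewrite rules that put the arguments of the symmetric trilinear forms in alphabetical order\<close>
  note trilinear =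
    T_cross_left_commute[of b a] T_cross_left_commute[of c a] T_cross_left_commute[of d a]
    T_cross_left_commute[of c b] T_cross_left_commute[of d b] T_cross_left_commute[of d c]
    T_cross_left[of _ _ a] T_cross_right[of a _ b] T_cross_right[of a d c]
    T_cross_left[of c d b] T_cross_right[of b d c]
  have combination:
    "defect a b c d + defect a c d b - defect a b d c -
      ((a \<boxtimes> d) \<boxtimes> (b \<boxtimes> c) + (a \<boxtimes> b) \<boxtimes> (d \<boxtimes> c) + (a \<boxtimes> c) \<boxtimes> (d \<boxtimes> b)) =
      - (T a (d \<boxtimes> b) \<cdot> c + T a (d \<boxtimes> c) \<cdot> b + T a (b \<boxtimes> c) \<cdot> d + T d (b \<boxtimes> c) \<cdot> a)"
    unfolding cross_cross_cross defect_eq_0 by simp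
  show ?thesis
    unfolding eq
  proof (rule prod_eqI)
    show "fst (V (0, a) (1, 0) (V (s, b) (t, c) (r, d)) - V (s, b) (t, c) (V (0, a) (1, 0) (r, d))) =
       fst (V (V (0, a) (1, 0) (s, b)) (t, c) (r, d) - V (s, b) (V (bar (0, a)) (1, 0) (t, c)) (r, d))"
      supply [[simproc del: int_combine_numerals]]
      apply (simp add: V_unit_eq bar_eq linear_simps)
      apply (simp add: V_eq linear_simps algebra_simps cross_commute)
      apply (simp add: cross_right cross_left)
      apply (simp add: algebra_simps cross_commute trilinear)
      done
    show "snd (V (0, a) (1, 0) (V (s, b) (t, c) (r, d)) - V (s, b) (t, c) (V (0, a) (1, 0) (r, d))) =
       snd (V (V (0, a) (1, 0) (s, b)) (t, c) (r, d) - V (s, b) (V (bar (0, a)) (1, 0) (t, c)) (r, d))"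
      supply [[simproc del: int_combine_numerals]]
      apply (simp add: V_unit_eq bar_eq linear_simps)
      apply (simp add: V_eq linear_simps algebra_simps cross_commute)
      using combination
      apply (simp add: defect_def algebra_simps cross_commute trilinear)
      done
  qed
qed

end

section \<open>Quadratic etale extensions in coordinates\<close>

text \<open>Here \<open>\<theta>\<close> is a square root of \<open>\<delta>\<close> outside \<open>F\<close>. The algebra \<open>K\<close> is a field if \<open>\<delta>\<close> is not a square in
  \<open>F\<close>, and it is split otherwise.\<close>

locale quadratic_conjugation =
  fixes \<phi> :: "'f::field \<Rightarrow> 'k::comm_ring_1" and \<sigma> :: "'k \<Rightarrow> 'k" and \<theta> :: 'k and \<delta> :: 'f
  assumes two: "(2 :: 'f) \<noteq> 0"
    and \<phi>_hom: "ring_hom_map \<phi>" and \<sigma>_hom: "ring_hom_map \<sigma>"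
    and \<sigma>_\<phi>: "\<sigma> (\<phi> x) = \<phi> x"
    and \<sigma>_\<theta>: "\<sigma> \<theta> = - \<theta>"
    and \<theta>_\<theta>: "\<theta> * \<theta> = \<phi> \<delta>" and \<delta>: "\<delta> \<noteq> 0"
    and coordinates: "\<exists>x y. t = \<phi> x + \<phi> y * \<theta>"
begin

lemma \<phi>_one: "\<phi> 1 = 1" and \<phi>_add: "\<phi> (x + y) = \<phi> x + \<phi> y" and \<phi>_mult: "\<phi> (x * y) = \<phi> x * \<phi> y"
  using \<phi>_hom by (auto simp: ring_hom_map_def)

lemma \<sigma>_one: "\<sigma> 1 = 1" and \<sigma>_add: "\<sigma> (x + y) = \<sigma> x + \<sigma> y" and \<sigma>_mult: "\<sigma> (x * y) = \<sigma> x * \<sigma> y"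
  using \<sigma>_hom by (auto simp: ring_hom_map_def)

lemma \<phi>_zero: "\<phi> 0 = 0" using \<phi>_add[of 0 0] by simp

lemma \<phi>_minus: "\<phi> (- x) = - \<phi> x"
  using \<phi>_add[of x "- x"] by (simp add: \<phi>_zero eq_neg_iff_add_eq_0 add.commute)

lemma \<phi>_unit: "x \<noteq> 0 \<Longrightarrow> \<phi> (inverse x) * \<phi> x = 1"
  by (simp add: \<phi>_mult[symmetric] \<phi>_one)

lemma \<sigma>_coordinates: "\<sigma> (\<phi> x + \<phi> y * \<theta>) = \<phi> x - \<phi> y * \<theta>"
  by (simp add: \<sigma>_add \<sigma>_mult \<sigma>_\<phi> \<sigma>_\<theta>)

lemma \<sigma>_\<sigma>: "\<sigma> (\<sigma> t) = t"
proof -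
  obtain x y where t: "t = \<phi> x + \<phi> y * \<theta>" using coordinates by blast
  show ?thesis
    unfolding t \<sigma>_coordinates using \<sigma>_coordinates[of x "- y"] by (simp add: \<phi>_minus)
qed

lemma \<phi>_half: "\<phi> (inverse 2) + \<phi> (inverse 2) = 1"
proof -
  have "inverse 2 + inverse 2 = (1::'f)"
    using two by (simp add: field_simps)
  then show ?thesis
    by (simp only: \<phi>_add[symmetric] \<phi>_one)
qed

lemma double_eq_0_K:
  assumes "t + t = (0::'k)"
  shows "t = 0"
proof -
  have "(\<phi> (inverse 2) + \<phi> (inverse 2)) * t = \<phi> (inverse 2) * (t + t)"
    by (simp only: distrib_left distrib_right)
  then show ?thesis by (simp only: \<phi>_half assms mult_1_left mult_zero_right)
qed

lemma \<sigma>_fixed: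
  assumes "\<sigma> t = t"
  obtains x where "t = \<phi> x"
proof -
  obtain x y where t: "t = \<phi> x + \<phi> y * \<theta>" using coordinates by blast
  have "\<phi> y * \<theta> + \<phi> y * \<theta> = t - \<sigma> t"
    unfolding t \<sigma>_coordinates by simp
  then have "\<phi> y * \<theta> + \<phi> y * \<theta> = 0"
    using assms by simp
  then have "\<phi> y * \<theta> = 0" by (rule double_eq_0_K)
  then show ?thesis using that t by simp
qed

lemma \<sigma>_skew:
  assumes "\<sigma> t = - t"
  obtains y where "t = \<phi> y * \<theta>"
proof -
  obtain x y where t: "t = \<phi> x + \<phi> y * \<theta>" using coordinates by blast
  have "\<phi> x + \<phi> x = t + \<sigma> t"
    unfolding t \<sigma>_coordinates by simp
  then have "\<phi> x + \<phi> x = 0"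
    using assms by simp
  then have "\<phi> x = 0" by (rule double_eq_0_K)
  then show ?thesis using that t by simp
qed

lemma \<theta>_unit: "(\<phi> (inverse \<delta>) * \<theta>) * \<theta> = 1"
  using \<phi>_unit[OF \<delta>] by (simp only: mult.assoc \<theta>_\<theta>)

lemma two_\<theta>_unit: "(\<phi> (inverse 2) * (\<phi> (inverse \<delta>) * \<theta>)) * (\<theta> + \<theta>) = 1"
proof -
  have "(\<phi> (inverse 2) * (\<phi> (inverse \<delta>) * \<theta>)) * (\<theta> + \<theta>) =
      (\<phi> (inverse 2) + \<phi> (inverse 2)) * ((\<phi> (inverse \<delta>) * \<theta>) * \<theta>)"
    by (simp only: distrib_left distrib_right mult_ac)
  then show ?thesis by (simp only: \<theta>_unit \<phi>_half mult_1_left)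
qed

text \<open>Non-degeneracy of the trace form: the functional \<open>t \<mapsto> t * s + \<sigma> (t * s)\<close> is not zero. One of the
  two coordinates of \<open>s\<close> is non-zero, and it is the trace of \<open>s / 2\<close> or of \<open>s / (2 \<theta>)\<close>.\<close>

lemma trace_eq_1:
  assumes "s \<noteq> 0"
  obtains t where "t * s + \<sigma> (t * s) = 1"
proof -
  obtain x y where s: "s = \<phi> x + \<phi> y * \<theta>" using coordinates by blast
  show ?thesis
  proof (cases "x = 0")
    case False
    then have x: "x + x \<noteq> 0" using two by (simp flip: mult_2)
    define t where "t = \<phi> (inverse (x + x))"
    have "t * s + \<sigma> (t * s) = t * (s + \<sigma> s)"
      by (simp add: t_def \<sigma>_mult \<sigma>_\<phi> distrib_left)
    also have "s + \<sigma> s = \<phi> (x + x)"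
      unfolding s \<sigma>_coordinates \<phi>_add by simp
    finally show ?thesis
      using that \<phi>_unit[OF x] by (simp only: t_def)
  next
    case True
    then have s: "s = \<phi> y * \<theta>" and y: "y \<noteq> 0" using s assms by (auto simp: \<phi>_zero)
    define t where "t = \<phi> (inverse 2) * (\<phi> (inverse y) * (\<phi> (inverse \<delta>) * \<theta>))"
    have "t * s = \<phi> (inverse 2) * ((\<phi> (inverse y) * \<phi> y) * ((\<phi> (inverse \<delta>) * \<theta>) * \<theta>))"
      unfolding t_def s by (simp only: mult_ac)
    then have "t * s = \<phi> (inverse 2)"
      by (simp only: \<phi>_unit[OF y] \<theta>_unit mult_1_right)
    then have "t * s + \<sigma> (t * s) = 1"
      by (simp only: \<sigma>_\<phi> \<phi>_half)
    then show ?thesis by (rule that)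
  qed
qed

text \<open>If the norm \<open>n * \<sigma> n\<close>, an element of \<open>F\<close>, is zero, then the trace \<open>2 x\<close> of \<open>n\<close> is not, and \<open>n / (2 x)\<close>
  has trace \<open>1\<close> and norm \<open>0\<close>. Hence it is idempotent, and this occurs only if \<open>K\<close> is split.\<close>

lemma unit_or_idempotent:
  assumes "n \<noteq> 0"
  obtains (unit) m where "m * n = 1"
    | (idempotent) e \<alpha> where "\<alpha> \<noteq> 0" "n = \<phi> \<alpha> * e" "e + \<sigma> e = 1" "e * \<sigma> e = 0" "e * e = e"
proof -
  obtain x y where n: "n = \<phi> x + \<phi> y * \<theta>" using coordinates by blast
  define \<nu> where "\<nu> = x * x - \<delta> * (y * y)"
  have norm: "\<sigma> n * n = \<phi> \<nu>"
  proof -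
    have "\<phi> \<nu> = \<phi> x * \<phi> x - (\<theta> * \<theta>) * (\<phi> y * \<phi> y)"
      using \<phi>_add[of "x * x" "- (\<delta> * (y * y))"] by (simp add: \<nu>_def \<phi>_minus \<phi>_mult \<theta>_\<theta>)
    then show ?thesis
      unfolding n \<sigma>_coordinates by (simp add: algebra_simps)
  qed
  show ?thesis
  proof (cases "\<nu> = 0")
    case False
    have "(\<phi> (inverse \<nu>) * \<sigma> n) * n = 1"
      using \<phi>_unit[OF False] by (simp only: mult.assoc norm)
    then show ?thesis by (rule unit)
  next
    case True
    have "x \<noteq> 0"
    proof
      assume "x = 0"
      then have "y = 0" using True \<delta> by (simp add: \<nu>_def)
      then show False using \<open>x = 0\<close> n assms by (simp add: \<phi>_zero)
    qed
    then have x: "x + x \<noteq> 0" using two by (simp flip: mult_2)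
    define e where "e = \<phi> (inverse (x + x)) * n"
    have n_e: "n = \<phi> (x + x) * e"
    proof -
      have "\<phi> (x + x) * e = (\<phi> (inverse (x + x)) * \<phi> (x + x)) * n"
        unfolding e_def by (simp only: mult_ac)
      then show ?thesis
        by (simp only: \<phi>_unit[OF x] mult_1_left)
    qed
    have \<sigma>e: "\<sigma> e = \<phi> (inverse (x + x)) * \<sigma> n"
      by (simp add: e_def \<sigma>_mult \<sigma>_\<phi>)
    have "n + \<sigma> n = \<phi> (x + x)"
      unfolding n \<sigma>_coordinates \<phi>_add by simp
    then have "\<phi> (inverse (x + x)) * n + \<phi> (inverse (x + x)) * \<sigma> n = 1"
      using \<phi>_unit[OF x] by (simp only: distrib_left[symmetric])
    then have sum: "e + \<sigma> e = 1"
      unfolding \<sigma>e by (simp only: e_def)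
    have "e * \<sigma> e = \<phi> (inverse (x + x)) * \<phi> (inverse (x + x)) * (\<sigma> n * n)"
      by (simp only: \<sigma>e, simp only: e_def mult_ac)
    then have prod: "e * \<sigma> e = 0"
      by (simp add: norm True \<phi>_zero)
    have "e * (e + \<sigma> e) = e * e + e * \<sigma> e" by (rule distrib_left)
    then have "e * e = e" by (simp add: sum prod)
    then show ?thesis using idempotent[OF x n_e sum prod] by blast
  qed
qed

end

text \<open>In \<open>F \<oplus> F\<close> the element \<open>\<theta> = (1, - 1)\<close> has the required properties, with \<open>\<theta>\<^sup>2 = 1\<close>.\<close>

lemma split_quadratic_conjugation:
  fixes \<phi> :: "'f::field \<Rightarrow> 'k::comm_ring_1"
  assumes two: "(2 :: 'f) \<noteq> 0" and "split_quadratic_extension \<phi> \<sigma>"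
  shows "\<exists>\<theta> \<delta>. quadratic_conjugation \<phi> \<sigma> \<theta> \<delta>"
proof -
  from assms(2) obtain p q :: "'k \<Rightarrow> 'f" where
    p: "ring_hom_map p" and q: "ring_hom_map q" and bij: "bij (\<lambda>t. (p t, q t))"
    and \<phi>: "\<And>x. p (\<phi> x) = x" "\<And>x. q (\<phi> x) = x"
    and \<sigma>: "\<And>t. p (\<sigma> t) = q t" "\<And>t. q (\<sigma> t) = p t"
    unfolding split_quadratic_extension_def by blast
  have eqI: "s = t" if "p s = p t" "q s = q t" for s t
    using injD[OF bij_is_inj[OF bij], of s t] that by simp
  have p_simps: "p 1 = 1" "p (x + y) = p x + p y" "p (x * y) = p x * p y"
    and q_simps: "q 1 = 1" "q (x + y) = q x + q y" "q (x * y) = q x * q y" for x y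
    using p q by (simp_all add: ring_hom_map_def)
  have minus: "p (- x) = - p x" "q (- x) = - q x" for x
  proof -
    have "p 0 = 0" "q 0 = 0" using p_simps(2)[of 0 0] q_simps(2)[of 0 0]
      by (simp_all only: add_0_right add_cancel_right_right)
    then show "p (- x) = - p x" "q (- x) = - q x"
      using p_simps(2)[of x "- x"] q_simps(2)[of x "- x"]
      by (simp_all add: eq_neg_iff_add_eq_0 add.commute)
  qed
  obtain \<theta> where "(1, - 1) = (p \<theta>, q \<theta>)"
    by (rule surjE[OF bij_is_surj[OF bij]])
  then have \<theta>: "p \<theta> = 1" "q \<theta> = - 1" by simp_all
  have "quadratic_conjugation \<phi> \<sigma> \<theta> 1"
  proof
    show "ring_hom_map \<phi>" "ring_hom_map \<sigma>"
      unfolding ring_hom_map_def by (auto intro!: eqI simp: p_simps q_simps \<phi> \<sigma>)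
    show "\<sigma> (\<phi> x) = \<phi> x" for x
      by (rule eqI) (simp_all add: \<phi> \<sigma>)
    show "\<sigma> \<theta> = - \<theta>" "\<theta> * \<theta> = \<phi> 1"
      by (rule eqI; simp add: \<phi> \<sigma> \<theta> minus p_simps q_simps)+
    show "\<exists>x y. t = \<phi> x + \<phi> y * \<theta>" for t
    proof -
      define h :: 'f where "h = inverse 2"
      have "h + h = 1" using two by (simp add: h_def field_simps)
      then have h: "h * a + h * a = a" for a
        by (simp only: distrib_right[symmetric] mult_1_left)
      have sum_diff: "(u + v) + (u - v) = u + u" "(u + v) - (u - v) = v + v" for u v :: 'f
        by simp_all
      have "t = \<phi> (h * p t + h * q t) + \<phi> (h * p t - h * q t) * \<theta>"
        by (rule eqI) (simp_all only: p_simps q_simps \<phi> \<theta> mult_1_right mult_minus_right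
            add_uminus_conv_diff sum_diff h)
      then show ?thesis by blast
    qed
  qed (use two in simp_all)
  then show ?thesis by blast
qed

text \<open>Completing the square in the equation of an element \<open>w\<close> outside \<open>F\<close> gives \<open>\<theta>\<close> with \<open>\<theta>\<^sup>2 \<in> F\<close>.
  The automorphism \<open>\<sigma>\<close> permutes the roots \<open>\<theta>\<close> and \<open>- \<theta>\<close> of \<open>X\<^sup>2 - \<theta>\<^sup>2\<close>, and it does not fix \<open>\<theta>\<close>
  because it would be the identity then.\<close>

lemma field_quadratic_conjugation:
  fixes \<phi> :: "'f::field \<Rightarrow> 'k::comm_ring_1"
  assumes two: "(2 :: 'f) \<noteq> 0"
    and "separable_quadratic_field_extension \<phi>" and "nontrivial_automorphism_over \<phi> \<sigma>"
  shows "\<exists>\<theta> \<delta>. quadratic_conjugation \<phi> \<sigma> \<theta> \<delta>"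
proof -
  from assms(2,3) have \<phi>_hom: "ring_hom_map \<phi>" and \<sigma>_hom: "ring_hom_map \<sigma>"
    and inv: "\<And>t::'k. t \<noteq> 0 \<Longrightarrow> \<exists>u. t * u = 1"
    and dim: "vector_space.dim (\<lambda>x t. \<phi> x * t) UNIV = 2"
    and \<sigma>_\<phi>: "\<And>x. \<sigma> (\<phi> x) = \<phi> x" and not_id: "\<sigma> \<noteq> id"
    unfolding separable_quadratic_field_extension_def nontrivial_automorphism_over_def by auto
  have \<phi>_simps: "\<phi> 1 = 1" "\<phi> (x + y) = \<phi> x + \<phi> y" "\<phi> (x * y) = \<phi> x * \<phi> y" for x y
    using \<phi>_hom by (simp_all add: ring_hom_map_def)
  have \<sigma>_simps: "\<sigma> 1 = 1" "\<sigma> (x + y) = \<sigma> x + \<sigma> y" "\<sigma> (x * y) = \<sigma> x * \<sigma> y" for x y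
    using \<sigma>_hom by (simp_all add: ring_hom_map_def)
  have no_zero_divisors: "s = 0 \<or> t = 0" if "s * t = (0::'k)" for s t
  proof (rule disjCI)
    assume "t \<noteq> 0"
    then obtain u where "t * u = 1" using inv by blast
    then have "s = (s * t) * u" by (simp add: mult.assoc)
    then show "s = 0" using that by simp
  qed
  have \<phi>_0: "\<phi> 0 = 0" using \<phi>_simps(2)[of 0 0] by simp
  have \<phi>_minus: "\<phi> (- x) = - \<phi> x" for x
    using \<phi>_simps(2)[of x "- x"] by (simp add: \<phi>_0 eq_neg_iff_add_eq_0 add.commute)
  interpret K: vector_space "\<lambda>x t. \<phi> x * t"
    by unfold_locales (simp_all add: \<phi>_simps algebra_simps)
  have "K.independent {1}" by (simp add: K.dependent_single)
  then have B: "{1} \<subseteq> K.extend_basis {1}" "K.independent (K.extend_basis {1})"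
      "K.span (K.extend_basis {1}) = UNIV"
    by (rule K.extend_basis_superset K.independent_extend_basis K.span_extend_basis)+
  define B where "B = K.extend_basis {1}"
  note B = B[folded B_def]
  have "card B = 2"
    using K.basis_card_eq_dim[of B UNIV] B dim by simp
  then obtain w where w: "B = {1, w}" "w \<noteq> 1"
    using B(1) by (auto simp: card_2_iff)
  have coord_w: "\<exists>x y. t = \<phi> x + \<phi> y * w" for t
  proof -
    have "t \<in> K.span {1, w}" using B(3) w(1) by simp
    then obtain x where "t - \<phi> x * 1 \<in> K.span {w}"
      using K.span_breakdown_eq by blast
    then obtain y where "t - \<phi> x * 1 = \<phi> y * w"
      by (auto simp: K.span_singleton)
    then have "t = \<phi> x + \<phi> y * w" by (simp add: diff_eq_eq add.commute)
    then show ?thesis by blast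
  qed
  have w_notin: "w \<noteq> \<phi> x" for x
  proof
    assume "w = \<phi> x"
    then have "w \<in> K.span {1}" by (auto simp: K.span_singleton)
    moreover have "w \<notin> K.span (B - {w})"
      using B(2) w(1) by (auto simp: K.dependent_def)
    ultimately show False using w by (simp add: insert_Diff_if)
  qed
  obtain c b where ww: "w * w = \<phi> c + \<phi> b * w" using coord_w by blast
  define g where "g = b / 2"
  define \<theta> where "\<theta> = w - \<phi> g"
  define \<delta> where "\<delta> = c + g * g"
  have w: "w = \<theta> + \<phi> g" by (simp add: \<theta>_def)
  have "b = g + g" using two by (simp add: g_def field_simps)
  then have b: "\<phi> b = \<phi> g + \<phi> g" by (simp only: \<phi>_simps(2))
  have \<theta>_\<theta>: "\<theta> * \<theta> = \<phi> \<delta>"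
  proof -
    have "\<theta> * \<theta> = w * w - \<phi> b * w + \<phi> g * \<phi> g"
      unfolding \<theta>_def b by (simp add: algebra_simps)
    then show ?thesis
      unfolding ww \<delta>_def by (simp add: \<phi>_simps)
  qed
  have \<theta>_0: "\<theta> \<noteq> 0" using w_notin[of g] by (simp add: \<theta>_def)
  have coord: "\<exists>x y. t = \<phi> x + \<phi> y * \<theta>" for t
  proof -
    obtain x y where "t = \<phi> x + \<phi> y * w" using coord_w by blast
    then have "t = \<phi> (x + y * g) + \<phi> y * \<theta>"
      unfolding w by (simp add: \<phi>_simps algebra_simps)
    then show ?thesis by blast
  qed
  have \<delta>_0: "\<delta> \<noteq> 0"
    using \<theta>_\<theta> \<theta>_0 no_zero_divisors[of \<theta> \<theta>] by (auto simp: \<phi>_0)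
  have "\<sigma> \<theta> \<noteq> \<theta>"
  proof
    assume fix_\<theta>: "\<sigma> \<theta> = \<theta>"
    have "\<sigma> t = t" for t
    proof -
      obtain x y where "t = \<phi> x + \<phi> y * \<theta>" using coord by blast
      then show ?thesis by (simp add: \<sigma>_simps \<sigma>_\<phi> fix_\<theta>)
    qed
    then show False using not_id by (auto simp: fun_eq_iff)
  qed
  moreover have "(\<sigma> \<theta> - \<theta>) * (\<sigma> \<theta> + \<theta>) = 0"
  proof -
    have "\<sigma> \<theta> * \<sigma> \<theta> = \<theta> * \<theta>"
      by (simp only: \<sigma>_simps(3)[symmetric] \<theta>_\<theta> \<sigma>_\<phi>)
    then show ?thesis by (simp add: algebra_simps)
  qed
  ultimately have "\<sigma> \<theta> + \<theta> = 0"
    using no_zero_divisors by force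
  then have "\<sigma> \<theta> = - \<theta>" by (simp add: eq_neg_iff_add_eq_0)
  then have "quadratic_conjugation \<phi> \<sigma> \<theta> \<delta>"
    by unfold_locales (use two \<phi>_hom \<sigma>_hom \<sigma>_\<phi> \<theta>_\<theta> \<delta>_0 coord in auto)
  then show ?thesis by blast
qed

section \<open>Hermitian cubic norm structures\<close>

locale cubic_norm_over = quadratic_conjugation \<phi> \<sigma> \<theta> \<delta>
  for \<phi> :: "'f::field \<Rightarrow> 'k::comm_ring_1" and \<sigma> :: "'k \<Rightarrow> 'k" and \<theta> :: 'k and \<delta> :: 'f +
  fixes smul :: "'k \<Rightarrow> 'j::ab_group_add \<Rightarrow> 'j" (infixr \<open>\<cdot>\<close> 76)
    and N :: "'j \<Rightarrow> 'k" and sharp :: "'j \<Rightarrow> 'j" and T :: "'j \<Rightarrow> 'j \<Rightarrow> 'k"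
  assumes three: "(3 :: 'f) \<noteq> 0"
    and cubic_norm: "hermitian_cubic_norm_structure \<sigma> smul N sharp T"
    and degenerate: "\<not> nondegenerate T \<Longrightarrow> quadratic_map (\<lambda>x. smul (\<phi> x)) sharp"
begin

sublocale module smul
  using cubic_norm by (simp add: hermitian_cubic_norm_structure_def)

abbreviation cross (infixl \<open>\<boxtimes>\<close> 78) where "cross \<equiv> polar sharp"

lemma hermitian: "hermitian_form \<sigma> smul T"
  and N_nonzero: "\<exists>a. N a \<noteq> 0"
  and sharp_scale: "sharp (t \<cdot> a) = (\<sigma> t)\<^sup>2 \<cdot> sharp a"
  and N_scale: "N (t \<cdot> a) = t ^ 3 * N a"
  and N_add: "N (a + b) = N a + T b (sharp a) + T a (sharp b) + N b"
  and sharp_sharp: "sharp (sharp a) = N a \<cdot> a"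
  using cubic_norm unfolding hermitian_cubic_norm_structure_def by blast+

lemma T_add_left: "T (a + b) c = T a c + T b c"
  and T_add_right: "T a (b + c) = T a b + T a c"
  and \<sigma>_T: "\<sigma> (T a b) = T b a"
  using hermitian unfolding hermitian_form_def by blast+

lemma T_scale: "T (s \<cdot> a) (t \<cdot> b) = s * \<sigma> t * T a b"
  using hermitian unfolding hermitian_form_def by blast

lemma T_scale_left: "T (s \<cdot> a) b = s * T a b"
  using T_scale[of s a 1 b] by (simp add: \<sigma>_one)

lemma T_scale_right: "T a (t \<cdot> b) = \<sigma> t * T a b"
  using T_scale[of 1 a t b] by simp

lemma T_diff_right: "T a (b - c) = T a b - T a c"
  using T_add_right[of a "b - c" c] by simp

lemma T_minus_left: "T (- a) b = - T a b"
  using T_scale_left[of "- 1" a b] by simp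

lemma sharp_add: "sharp (a + b) = sharp a + sharp b + a \<boxtimes> b"
  by (simp add: polar_def)

lemma cross_commute: "a \<boxtimes> b = b \<boxtimes> a"
  by (simp add: polar_def add.commute)

text \<open>Compare the expansions of \<open>N\<close> at \<open>(a + b) + c\<close> and at \<open>a + (b + c)\<close>.\<close>

lemma T_cross_rotate: "T a (b \<boxtimes> c) = T c (a \<boxtimes> b)"
proof -
  have "N (a + b + c) = N (a + (b + c))" by (simp only: add.assoc)
  then have "T c (sharp (a + b)) - T c (sharp a) - T c (sharp b) =
      T a (sharp (b + c)) - T a (sharp b) - T a (sharp c)"
    unfolding N_add[of "a + b" c] N_add[of a "b + c"] N_add[of a b] N_add[of b c]
      T_add_left[of a b] T_add_left[of b c]
    by (simp add: algebra_simps)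
  then show ?thesis
    by (simp only: polar_def T_diff_right)
qed

lemma T_cross_left_commute: "T a (b \<boxtimes> c) = T b (a \<boxtimes> c)"
  by (simp only: T_cross_rotate[of a b c] cross_commute[of a b] T_cross_rotate[of b a c, symmetric])

text \<open>For non-degenerate \<open>T\<close> this and the next lemma follow from the symmetry of \<open>T a (b \<boxtimes> c)\<close>, which
  moves the argument in question to the linear side of \<open>T\<close>. For degenerate \<open>T\<close> additivity is part of the
  quadraticity of \<open>\<sharp>\<close>.\<close>

lemma cross_add_left: "(a + b) \<boxtimes> c = a \<boxtimes> c + b \<boxtimes> c"
proof (cases "nondegenerate T")
  case True
  have "T x ((a + b) \<boxtimes> c - (a \<boxtimes> c + b \<boxtimes> c)) = 0" for x
    by (simp only: T_diff_right T_add_right T_cross_left_commute[of x _ c] T_add_left diff_self)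
  then have "T ((a + b) \<boxtimes> c - (a \<boxtimes> c + b \<boxtimes> c)) x = 0" for x
    by (metis \<sigma>_T \<sigma>_add add_cancel_left_left)
  then have "(a + b) \<boxtimes> c - (a \<boxtimes> c + b \<boxtimes> c) = 0"
    using True unfolding nondegenerate_def by blast
  then show ?thesis by simp
next
  case False
  then show ?thesis
    using degenerate unfolding quadratic_map_def by (simp add: Vector_Spaces.linear_iff)
qed

text \<open>For degenerate \<open>T\<close>, \<open>F\<close>-bilinearity of \<open>\<boxtimes>\<close> is known, so only the scalar \<open>\<theta>\<close> is left. Polarising
  \<open>(s \<cdot> a)\<sharp> = (\<sigma> s)\<^sup>2 \<cdot> a\<sharp>\<close> gives \<open>(s \<cdot> a) \<boxtimes> (s \<cdot> b) = (\<sigma> s)\<^sup>2 \<cdot> (a \<boxtimes> b)\<close>. Comparing this for \<open>s = \<theta>\<close> and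
  for \<open>s = 1 + \<theta>\<close> yields \<open>\<theta> a \<boxtimes> b + a \<boxtimes> \<theta> b = - 2 \<theta> (a \<boxtimes> b)\<close>, and replacing \<open>a\<close> by \<open>\<theta> \<cdot> a\<close>
  in the latter isolates \<open>\<theta> a \<boxtimes> b\<close>.\<close>

lemma cross_scale_left: "(t \<cdot> a) \<boxtimes> c = \<sigma> t \<cdot> (a \<boxtimes> c)"
proof (cases "nondegenerate T")
  case True
  have "T x ((t \<cdot> a) \<boxtimes> c - \<sigma> t \<cdot> (a \<boxtimes> c)) = 0" for x
    by (simp only: T_diff_right T_scale_right T_cross_left_commute[of x _ c] T_scale_left \<sigma>_\<sigma> diff_self)
  then have "T ((t \<cdot> a) \<boxtimes> c - \<sigma> t \<cdot> (a \<boxtimes> c)) x = 0" for x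
    by (metis \<sigma>_T \<sigma>_add add_cancel_left_left)
  then have "(t \<cdot> a) \<boxtimes> c - \<sigma> t \<cdot> (a \<boxtimes> c) = 0"
    using True unfolding nondegenerate_def by blast
  then show ?thesis by simp
next
  case False
  then have F_left: "(\<phi> x \<cdot> a) \<boxtimes> b = \<phi> x \<cdot> (a \<boxtimes> b)" for x a b
    using degenerate unfolding quadratic_map_def by (simp add: Vector_Spaces.linear_iff)
  have both: "(s \<cdot> a) \<boxtimes> (s \<cdot> b) = (\<sigma> s)\<^sup>2 \<cdot> (a \<boxtimes> b)" for s a b
    by (simp add: polar_def sharp_scale scale_right_distrib[symmetric] scale_right_diff_distrib[symmetric])
  have cross_add_right: "a \<boxtimes> (b + c) = a \<boxtimes> b + a \<boxtimes> c" for a b c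
    by (simp only: cross_commute[of a] cross_add_left)
  have mixed: "(\<theta> \<cdot> a) \<boxtimes> b + a \<boxtimes> (\<theta> \<cdot> b) = - ((\<theta> + \<theta>) \<cdot> (a \<boxtimes> b))" for a b
  proof -
    have "(a + \<theta> \<cdot> a) \<boxtimes> (b + \<theta> \<cdot> b) = (1 - \<theta>)\<^sup>2 \<cdot> (a \<boxtimes> b)"
      using both[of "1 + \<theta>" a b] by (simp add: scale_left_distrib \<sigma>_add \<sigma>_one \<sigma>_\<theta>)
    moreover have "(\<theta> \<cdot> a) \<boxtimes> (\<theta> \<cdot> b) = (\<theta> * \<theta>) \<cdot> (a \<boxtimes> b)"
      using both[of \<theta> a b] by (simp add: \<sigma>_\<theta> power2_eq_square)
    moreover have "(1 - \<theta>)\<^sup>2 = 1 - (\<theta> + \<theta>) + \<theta> * \<theta>"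
      by (simp add: power2_eq_square algebra_simps)
    ultimately have "a \<boxtimes> b + (\<theta> \<cdot> a) \<boxtimes> b + (a \<boxtimes> (\<theta> \<cdot> b) + (\<theta> * \<theta>) \<cdot> (a \<boxtimes> b)) =
        a \<boxtimes> b - (\<theta> + \<theta>) \<cdot> (a \<boxtimes> b) + (\<theta> * \<theta>) \<cdot> (a \<boxtimes> b)"
      by (simp only: cross_add_left cross_add_right scale_left_distrib scale_left_diff_distrib scale_one)
    then show ?thesis by (simp add: eq_neg_iff_add_eq_0 algebra_simps)
  qed
  have \<theta>_left: "(\<theta> \<cdot> a) \<boxtimes> b = - \<theta> \<cdot> (a \<boxtimes> b)" for a b
  proof -
    have "(\<theta> \<cdot> \<theta> \<cdot> a) \<boxtimes> b + (\<theta> \<cdot> a) \<boxtimes> (\<theta> \<cdot> b) = - ((\<theta> + \<theta>) \<cdot> ((\<theta> \<cdot> a) \<boxtimes> b))"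
      by (rule mixed)
    moreover have "(\<theta> \<cdot> \<theta> \<cdot> a) \<boxtimes> b = (\<theta> * \<theta>) \<cdot> (a \<boxtimes> b)"
      by (simp add: \<theta>_\<theta> F_left)
    moreover have "(\<theta> \<cdot> a) \<boxtimes> (\<theta> \<cdot> b) = (\<theta> * \<theta>) \<cdot> (a \<boxtimes> b)"
      using both[of \<theta> a b] by (simp add: \<sigma>_\<theta> power2_eq_square)
    ultimately have "(\<theta> * \<theta>) \<cdot> (a \<boxtimes> b) + (\<theta> * \<theta>) \<cdot> (a \<boxtimes> b) = - ((\<theta> + \<theta>) \<cdot> ((\<theta> \<cdot> a) \<boxtimes> b))"
      by (simp only:)
    then have "(\<theta> + \<theta>) \<cdot> ((\<theta> \<cdot> a) \<boxtimes> b) = - ((\<theta> * \<theta>) \<cdot> (a \<boxtimes> b) + (\<theta> * \<theta>) \<cdot> (a \<boxtimes> b))"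
      by (simp only: minus_minus)
    also have "\<dots> = (\<theta> + \<theta>) \<cdot> (- \<theta> \<cdot> (a \<boxtimes> b))"
    proof -
      have "(\<theta> + \<theta>) * - \<theta> = - (\<theta> * \<theta> + \<theta> * \<theta>)"
        by (simp only: mult_minus_right distrib_right)
      then have "((\<theta> + \<theta>) * - \<theta>) \<cdot> (a \<boxtimes> b) = - ((\<theta> * \<theta>) \<cdot> (a \<boxtimes> b) + (\<theta> * \<theta>) \<cdot> (a \<boxtimes> b))"
        by (simp only: scale_minus_left scale_left_distrib)
      then show ?thesis
        by (simp only: scale_scale)
    qed
    finally have "(\<theta> + \<theta>) \<cdot> ((\<theta> \<cdot> a) \<boxtimes> b) = (\<theta> + \<theta>) \<cdot> (- \<theta> \<cdot> (a \<boxtimes> b))" .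
    then have "(\<phi> (inverse 2) * (\<phi> (inverse \<delta>) * \<theta>) * (\<theta> + \<theta>)) \<cdot> ((\<theta> \<cdot> a) \<boxtimes> b) =
       (\<phi> (inverse 2) * (\<phi> (inverse \<delta>) * \<theta>) * (\<theta> + \<theta>)) \<cdot> (- \<theta> \<cdot> (a \<boxtimes> b))"
      by (simp only: scale_scale[symmetric])
    then show ?thesis by (simp only: two_\<theta>_unit scale_one)
  qed
  obtain x y where t: "t = \<phi> x + \<phi> y * \<theta>" using coordinates by blast
  have "(t \<cdot> a) \<boxtimes> c = \<phi> x \<cdot> (a \<boxtimes> c) + \<phi> y \<cdot> (- \<theta> \<cdot> (a \<boxtimes> c))"
    unfolding t by (simp only: scale_left_distrib scale_scale[symmetric] cross_add_left F_left \<theta>_left)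
  also have "\<dots> = \<sigma> t \<cdot> (a \<boxtimes> c)"
    unfolding t \<sigma>_coordinates by (simp add: scale_left_diff_distrib)
  finally show ?thesis .
qed

lemma cross_add_right: "a \<boxtimes> (b + c) = a \<boxtimes> b + a \<boxtimes> c"
  by (simp only: cross_commute[of a] cross_add_left)

lemma cross_minus_left: "(- a) \<boxtimes> c = - (a \<boxtimes> c)"
  using cross_add_left[of "- a" a c] cross_add_left[of 0 0 c] by (simp add: eq_neg_iff_add_eq_0)

lemma cross_minus_right: "c \<boxtimes> (- a) = - (c \<boxtimes> a)"
  by (simp only: cross_commute[of c] cross_minus_left)

lemma \<sigma>_minus_one: "\<sigma> (- 1) = - 1"
  using \<sigma>_add[of 1 "- 1"] \<sigma>_add[of 0 0] by (simp add: \<sigma>_one eq_neg_iff_add_eq_0 add.commute)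

lemma sharp_minus: "sharp (- a) = sharp a"
  using sharp_scale[of "- 1" a] by (simp add: \<sigma>_minus_one)

lemma N_minus: "N (- a) = - N a"
  using N_scale[of "- 1" a] by simp

lemma double_eq_0:
  assumes "a + a = (0::'j)"
  shows "a = 0"
proof -
  have "(\<phi> (inverse 2) + \<phi> (inverse 2)) \<cdot> a = \<phi> (inverse 2) \<cdot> (a + a)"
    by (simp only: scale_left_distrib scale_right_distrib)
  then show ?thesis
    using assms by (simp only: \<phi>_half scale_one scale_zero_right)
qed

lemma cross_self: "a \<boxtimes> a = sharp a + sharp a"
proof -
  have "sharp ((1 + 1) \<cdot> a) = (1 + 1)\<^sup>2 \<cdot> sharp a"
    unfolding sharp_scale by (simp only: \<sigma>_add \<sigma>_one)
  also have "(1 + 1 :: 'k)\<^sup>2 = (1 + 1) + (1 + 1)" by simp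
  finally have "sharp (a + a) = (sharp a + sharp a) + (sharp a + sharp a)"
    by (simp only: scale_left_distrib scale_one)
  then show ?thesis by (simp add: sharp_add)
qed

lemma T_sharp: "T a (sharp a) = N a + N a + N a"
proof -
  have "N ((1 + 1) \<cdot> a) = (1 + 1) ^ 3 * N a" by (rule N_scale)
  then have "N a + T a (sharp a) + T a (sharp a) + N a = (1 + 1) ^ 3 * N a"
    by (simp only: scale_left_distrib scale_one N_add)
  also have "(1 + 1 :: 'k) ^ 3 = 8" by simp
  finally have "(T a (sharp a) - (N a + N a + N a)) + (T a (sharp a) - (N a + N a + N a)) = 0"
    by (simp add: algebra_simps)
  from double_eq_0_K[OF this] show ?thesis by simp
qed

text \<open>The part of degree two in \<open>a\<close> and two in \<open>b\<close> of \<open>(a + b)\<sharp>\<sharp> = N (a + b) \<cdot> (a + b)\<close>. Adding the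
  equation for \<open>- b\<close> removes the parts of odd degree in \<open>b\<close>, and the terms in \<open>a\<close> alone and in \<open>b\<close>
  alone cancel by \<open>a\<sharp>\<sharp> = N a \<cdot> a\<close>. Only the scalar \<open>- 1\<close> is used, so that small fields \<open>F\<close> cause
  no difficulty.\<close>

lemma sharp_cross: "sharp (a \<boxtimes> b) + sharp a \<boxtimes> sharp b = T b (sharp a) \<cdot> b + T a (sharp b) \<cdot> a"
proof -
  have plus: "sharp (sharp a + sharp b + a \<boxtimes> b) =
      N a \<cdot> a + N b \<cdot> b + sharp (a \<boxtimes> b) + sharp a \<boxtimes> sharp b + (sharp a + sharp b) \<boxtimes> (a \<boxtimes> b)"
    unfolding sharp_add[of "sharp a + sharp b"] sharp_add[of "sharp a" "sharp b"] sharp_sharp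
    by (simp only: add_ac)
  have minus: "sharp (sharp a + sharp b + - (a \<boxtimes> b)) =
      N a \<cdot> a + N b \<cdot> b + sharp (a \<boxtimes> b) + sharp a \<boxtimes> sharp b - (sharp a + sharp b) \<boxtimes> (a \<boxtimes> b)"
    unfolding sharp_add[of "sharp a + sharp b"] sharp_add[of "sharp a" "sharp b"] sharp_sharp
      sharp_minus cross_minus_right
    by (simp add: algebra_simps)
  have "sharp (sharp (a + b)) = N (a + b) \<cdot> (a + b)" by (rule sharp_sharp)
  then have eq1: "N a \<cdot> a + N b \<cdot> b + sharp (a \<boxtimes> b) + sharp a \<boxtimes> sharp b + (sharp a + sharp b) \<boxtimes> (a \<boxtimes> b)
      = (N a + T b (sharp a) + T a (sharp b) + N b) \<cdot> (a + b)"
    by (simp only: sharp_add[of a b] plus N_add)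
  have "sharp (sharp (a + - b)) = N (a + - b) \<cdot> (a + - b)" by (rule sharp_sharp)
  then have eq2: "N a \<cdot> a + N b \<cdot> b + sharp (a \<boxtimes> b) + sharp a \<boxtimes> sharp b - (sharp a + sharp b) \<boxtimes> (a \<boxtimes> b)
      = (N a + - T b (sharp a) + T a (sharp b) + - N b) \<cdot> (a + - b)"
    by (simp only: sharp_add[of a "- b"] sharp_minus cross_minus_right minus N_add T_minus_left N_minus)
  define X where "X = sharp (a \<boxtimes> b) + sharp a \<boxtimes> sharp b"
  define Y where "Y = T b (sharp a) \<cdot> b + T a (sharp b) \<cdot> a"
  define Z where "Z = (sharp a + sharp b) \<boxtimes> (a \<boxtimes> b)"
  define W where "W = (N a + T a (sharp b)) \<cdot> b + (T b (sharp a) + N b) \<cdot> a"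
  have "X + Z = Y + W - N a \<cdot> b + N a \<cdot> b"
    using eq1 unfolding X_def Y_def Z_def W_def by (simp add: algebra_simps)
  moreover have "X - Z = Y - W"
    using eq2 unfolding X_def Y_def Z_def W_def by (simp add: algebra_simps)
  ultimately have "(X + Z) + (X - Z) = (Y + W) + (Y - W)" by simp
  then have "(X - Y) + (X - Y) = 0" by (simp add: algebra_simps)
  from double_eq_0[OF this] show ?thesis
    unfolding X_def Y_def by simp
qed

lemma sharp_cross_linearized:
  "(a \<boxtimes> b) \<boxtimes> (c \<boxtimes> b) + (a \<boxtimes> c) \<boxtimes> sharp b = T b (a \<boxtimes> c) \<cdot> b + T a (sharp b) \<cdot> c + T c (sharp b) \<cdot> a"
proof -
  have sum: "sharp (a \<boxtimes> b) + sharp (c \<boxtimes> b) + (a \<boxtimes> b) \<boxtimes> (c \<boxtimes> b)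
      + (sharp a \<boxtimes> sharp b + sharp c \<boxtimes> sharp b + (a \<boxtimes> c) \<boxtimes> sharp b) =
      (T b (sharp a) + T b (sharp c) + T b (a \<boxtimes> c)) \<cdot> b + (T a (sharp b) + T c (sharp b)) \<cdot> (a + c)"
    using sharp_cross[of "a + c" b] by (simp only: cross_add_left sharp_add T_add_left T_add_right)
  have "(a \<boxtimes> b) \<boxtimes> (c \<boxtimes> b) + (a \<boxtimes> c) \<boxtimes> sharp b =
      (sharp (a \<boxtimes> b) + sharp (c \<boxtimes> b) + (a \<boxtimes> b) \<boxtimes> (c \<boxtimes> b)
      + (sharp a \<boxtimes> sharp b + sharp c \<boxtimes> sharp b + (a \<boxtimes> c) \<boxtimes> sharp b))
      - (sharp (a \<boxtimes> b) + sharp a \<boxtimes> sharp b) - (sharp (c \<boxtimes> b) + sharp c \<boxtimes> sharp b)"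
    by (simp add: algebra_simps)
  also have "\<dots> = T b (a \<boxtimes> c) \<cdot> b + T a (sharp b) \<cdot> c + T c (sharp b) \<cdot> a"
    unfolding sum sharp_cross by (simp add: algebra_simps)
  finally show ?thesis .
qed

lemma cross_cross_cross:
  "(a \<boxtimes> b) \<boxtimes> (c \<boxtimes> d) + (a \<boxtimes> c) \<boxtimes> (b \<boxtimes> d) + (a \<boxtimes> d) \<boxtimes> (b \<boxtimes> c) =
   T a (b \<boxtimes> c) \<cdot> d + T a (b \<boxtimes> d) \<cdot> c + T a (c \<boxtimes> d) \<cdot> b + T b (c \<boxtimes> d) \<cdot> a"
proof -
  define L where "L b = (a \<boxtimes> b) \<boxtimes> (c \<boxtimes> b) + (a \<boxtimes> c) \<boxtimes> sharp b" for b
  define R where "R b = T b (a \<boxtimes> c) \<cdot> b + T a (sharp b) \<cdot> c + T c (sharp b) \<cdot> a" for b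
  have "(a \<boxtimes> b) \<boxtimes> (c \<boxtimes> d) + (a \<boxtimes> d) \<boxtimes> (c \<boxtimes> b) + (a \<boxtimes> c) \<boxtimes> (b \<boxtimes> d) = L (b + d) - L b - L d"
    unfolding L_def cross_add_right cross_add_left sharp_add by (simp add: algebra_simps)
  also have "\<dots> = R (b + d) - R b - R d"
    unfolding L_def R_def sharp_cross_linearized ..
  also have "\<dots> = T b (a \<boxtimes> c) \<cdot> d + T d (a \<boxtimes> c) \<cdot> b + T a (b \<boxtimes> d) \<cdot> c + T c (b \<boxtimes> d) \<cdot> a"
    unfolding R_def sharp_add T_add_left T_add_right by (simp add: algebra_simps)
  finally show ?thesis
    by (simp only: cross_commute[of c b] cross_commute[of c d] T_cross_left_commute[of b a] T_cross_left_commute[of c b]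
        T_cross_left_commute[of d a] add_ac)
qed

lemma \<phi>_third: "\<phi> (inverse 3) + \<phi> (inverse 3) + \<phi> (inverse 3) = 1"
  by (simp only: \<phi>_add[symmetric] sum_of_thirds[OF three] \<phi>_one)

lemma N_sharp: "N (sharp a) = \<sigma> (N a) * \<sigma> (N a)"
proof -
  have "N (sharp a) + N (sharp a) + N (sharp a) = T (sharp a) (N a \<cdot> a)"
    using T_sharp[of "sharp a"] by (simp only: sharp_sharp)
  also have "\<dots> = \<sigma> (N a) * \<sigma> (T a (sharp a))"
    by (simp only: T_scale_right \<sigma>_T)
  also have "\<dots> = \<sigma> (N a) * \<sigma> (N a) + \<sigma> (N a) * \<sigma> (N a) + \<sigma> (N a) * \<sigma> (N a)"
    by (simp only: T_sharp \<sigma>_add distrib_left)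
  finally have "\<phi> (inverse 3) * (N (sharp a) + N (sharp a) + N (sharp a)) =
      \<phi> (inverse 3) * (\<sigma> (N a) * \<sigma> (N a) + \<sigma> (N a) * \<sigma> (N a) + \<sigma> (N a) * \<sigma> (N a))"
    by simp
  then have "(\<phi> (inverse 3) + \<phi> (inverse 3) + \<phi> (inverse 3)) * N (sharp a) =
      (\<phi> (inverse 3) + \<phi> (inverse 3) + \<phi> (inverse 3)) * (\<sigma> (N a) * \<sigma> (N a))"
    by (simp only: distrib_right distrib_left)
  then show ?thesis
    by (simp only: \<phi>_third mult_1_left)
qed

text \<open>If \<open>N a\<close> is a zero divisor, then it is \<open>\<alpha> e\<close> with an idempotent \<open>e\<close>, so \<open>N (e \<cdot> a) = \<alpha> e\<close> and
  \<open>N (\<sigma> e \<cdot> a\<sharp>) = \<alpha>\<^sup>2 \<sigma> e\<close> by \<open>N_sharp\<close>. The mixed terms of \<open>N (e \<cdot> a + \<sigma> e \<cdot> a\<sharp>)\<close> vanish because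
  \<open>e * \<sigma> e = 0\<close>, and the sum of the other two is invertible.\<close>

lemma regular_element: "\<exists>c m. m * N c = 1"
proof -
  obtain a where a: "N a \<noteq> 0" using N_nonzero by blast
  from a show ?thesis
  proof (cases rule: unit_or_idempotent)
    case (unit m)
    then show ?thesis by blast
  next
    case (idempotent e \<alpha>)
    note e = idempotent
    have e': "\<sigma> e * e = 0" "\<sigma> e * \<sigma> e = \<sigma> e"
      using e(4,5) by (simp_all only: mult.commute[of "\<sigma> e"] \<sigma>_mult[symmetric])
    define c where "c = e \<cdot> a + \<sigma> e \<cdot> sharp a"
    have cross_terms: "T (\<sigma> e \<cdot> sharp a) (sharp (e \<cdot> a)) = 0" "T (e \<cdot> a) (sharp (\<sigma> e \<cdot> sharp a)) = 0"
      by (simp_all add: sharp_scale T_scale \<sigma>_\<sigma> \<sigma>_mult power2_eq_square e' e)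
    have "e ^ 3 = e" "\<sigma> e ^ 3 = \<sigma> e"
      by (simp_all only: power3_eq_cube e e')
    then have "N (e \<cdot> a) = \<phi> \<alpha> * (e * e)" "N (\<sigma> e \<cdot> sharp a) = (\<phi> \<alpha> * \<phi> \<alpha>) * ((\<sigma> e * \<sigma> e) * \<sigma> e)"
      unfolding N_scale N_sharp e(2) \<sigma>_mult \<sigma>_\<phi>
      by (simp_all only: mult_ac)
    then have Nc: "N c = \<phi> \<alpha> * e + \<phi> (\<alpha> * \<alpha>) * \<sigma> e"
      unfolding c_def N_add cross_terms by (simp add: e e' \<phi>_mult)
    have "\<alpha> * \<alpha> \<noteq> 0" using e(1) by simp
    have "(\<phi> (inverse \<alpha>) * e + \<phi> (inverse (\<alpha> * \<alpha>)) * \<sigma> e) * N c =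
       (\<phi> (inverse \<alpha>) * \<phi> \<alpha>) * (e * e) + \<phi> (inverse \<alpha>) * \<phi> (\<alpha> * \<alpha>) * (e * \<sigma> e)
       + \<phi> (inverse (\<alpha> * \<alpha>)) * \<phi> \<alpha> * (e * \<sigma> e)
       + (\<phi> (inverse (\<alpha> * \<alpha>)) * \<phi> (\<alpha> * \<alpha>)) * (\<sigma> e * \<sigma> e)"
      unfolding Nc by (simp only: distrib_left distrib_right mult_ac add_ac)
    also have "\<dots> = e + \<sigma> e"
      unfolding e(4,5) e' \<phi>_unit[OF e(1)] \<phi>_unit[OF \<open>\<alpha> * \<alpha> \<noteq> 0\<close>] by simp
    finally show ?thesis using e(3) by auto
  qed
qed

sublocale hermitian_cross_module smul \<sigma> T "polar sharp" "\<phi> (inverse 2)" "\<phi> (inverse 3)"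
proof
  obtain c m where m: "m * N c = 1" using regular_element by blast
  have "T c (c \<boxtimes> c) = (N c + N c + N c) + (N c + N c + N c)"
    by (simp only: cross_self T_add_right T_sharp)
  then have "(\<phi> (inverse 2) * \<phi> (inverse 3) * m) * T c (c \<boxtimes> c) =
     (\<phi> (inverse 2) + \<phi> (inverse 2)) * ((\<phi> (inverse 3) + \<phi> (inverse 3) + \<phi> (inverse 3)) * (m * N c))"
    by (simp only: distrib_left distrib_right mult_ac add_ac)
  then have "(\<phi> (inverse 2) * \<phi> (inverse 3) * m) * T c (c \<boxtimes> c) = 1"
    by (simp only: \<phi>_half \<phi>_third m mult_1_left)
  then show "\<exists>c m. m * T c (c \<boxtimes> c) = 1" by blast
qed (rule \<sigma>_add \<sigma>_mult \<sigma>_\<sigma> T_add_left T_scale_left \<sigma>_T cross_commute cross_add_left cross_scale_left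
    T_cross_left_commute cross_cross_cross \<phi>_half \<phi>_third)+

section \<open>Structurability, skew-dimension, centre and ideals\<close>

lemma KJ_mul_eq: "KJ_mul \<sigma> smul sharp T = mul"
  by (simp add: KJ_mul_def mul_def fun_eq_iff)

lemma KJ_bar_eq: "KJ_bar \<sigma> = bar"
  by (simp add: KJ_bar_def bar_def fun_eq_iff)

lemma KJ_scale_eq: "KJ_scale \<phi> smul x (s, b) = (\<phi> x * s, \<phi> x \<cdot> b)"
  by (simp add: KJ_scale_def)

lemma vector_space_KJ: "vector_space (KJ_scale \<phi> smul)"
  by unfold_locales
    (auto simp: KJ_scale_def \<phi>_add \<phi>_mult \<phi>_one algebra_simps)

sublocale KJ: algebra_with_involution "KJ_scale \<phi> smul" mul "(1, 0)" bar
proof (intro algebra_with_involution.intro algebra_with_involution_axioms.intro vector_space_KJ)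
  show "Vector_Spaces.linear (KJ_scale \<phi> smul) (KJ_scale \<phi> smul) (mul x)" for x
    by (cases x)
      (auto simp: Vector_Spaces.linear_iff vector_space_KJ mul_eq KJ_scale_eq linear_simps \<sigma>_\<phi> mult_ac add_ac distrib_left distrib_right)
  show "Vector_Spaces.linear (KJ_scale \<phi> smul) (KJ_scale \<phi> smul) (\<lambda>x. mul x y)" for y
    by (cases y)
      (auto simp: Vector_Spaces.linear_iff vector_space_KJ mul_eq KJ_scale_eq linear_simps \<sigma>_\<phi> mult_ac add_ac distrib_left distrib_right)
  show "Vector_Spaces.linear (KJ_scale \<phi> smul) (KJ_scale \<phi> smul) bar"
    by (auto simp: Vector_Spaces.linear_iff vector_space_KJ bar_eq KJ_scale_eq linear_simps \<sigma>_\<phi>)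
  show "mul (1, 0) x = x" "mul x (1, 0) = x" for x
    by (cases x; simp add: mul_eq linear_simps)+
  show "bar (bar x) = x" for x
    by (cases x) (simp add: bar_eq linear_simps)
  show "bar (mul x y) = mul (bar y) (bar x)" for x y
    by (cases x, cases y) (simp add: mul_eq bar_eq linear_simps cross_commute mult_ac add_ac)
qed

lemma KJ_structurable: "structurable_algebra (KJ_scale \<phi> smul) mul (1, 0) bar"
proof (unfold_locales, rule KJ.structurable_identity_if_unit[OF three])
  fix z x y u :: "'k \<times> 'j"
  obtain p a where z: "z = (p, 0) + (0, a)" by (cases z) auto
  show "V z (1, 0) (V x y u) - V x y (V z (1, 0) u) =
      V (V z (1, 0) x) y u - V x (V (bar z) (1, 0) y) u"
    unfolding z KJ.V_add KJ.bar_add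
    using arg_cong2[OF V_unit_scalar_identity[of p x y u] V_unit_vector_identity[of a x y u], of plus]
    by (simp add: algebra_simps)
qed

lemma KJ_skew_dimension: "skew_dimension (KJ_scale \<phi> smul) (bar :: 'k \<times> 'j \<Rightarrow> 'k \<times> 'j) = 1"
proof -
  have skew: "{x. bar x = - x} = KJ.span {(\<theta>, 0)}"
  proof (intro equalityI subsetI)
    fix x :: "'k \<times> 'j" assume "x \<in> {x. bar x = - x}"
    then obtain s b where x: "x = (s, b)" "\<sigma> s = - s" "b = - b"
      by (cases x) (auto simp: bar_eq)
    then have "b = 0" using double_eq_0[of b] by (simp add: eq_neg_iff_add_eq_0)
    moreover obtain y where "s = \<phi> y * \<theta>" using \<sigma>_skew x(2) by blast
    ultimately have "x = KJ_scale \<phi> smul y (\<theta>, 0)"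
      by (simp add: x(1) KJ_scale_eq)
    then show "x \<in> KJ.span {(\<theta>, 0)}"
      by (auto simp: KJ.span_singleton)
  next
    fix x :: "'k \<times> 'j" assume "x \<in> KJ.span {(\<theta>, 0)}"
    then show "x \<in> {x. bar x = - x}"
      by (auto simp: KJ.span_singleton bar_eq KJ_scale_eq linear_simps \<sigma>_\<phi> \<sigma>_\<theta>)
  qed
  have "KJ.independent {(\<theta>, 0::'j)}"
    using \<theta>_unit by (auto simp: KJ.dependent_single zero_prod_def)
  then have "KJ.dim (KJ.span {(\<theta>, 0::'j)}) = card {(\<theta>, 0::'j)}"
    by (rule KJ.dim_span_eq_card_independent)
  then show ?thesis
    unfolding skew_dimension_def skew by simp
qed

text \<open>A central element is fixed by the involution, so its \<open>K\<close>-component lies in \<open>F\<close>. Commuting with \<open>(\<theta>, 0)\<close>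
  forces its \<open>J\<close>-component to vanish.\<close>

lemma KJ_central: "central_algebra (KJ_scale \<phi> smul) mul (1, 0) (bar :: 'k \<times> 'j \<Rightarrow> 'k \<times> 'j)"
  unfolding central_algebra_def
proof (intro equalityI subsetI)
  fix x :: "'k \<times> 'j" assume "x \<in> algebra_center mul bar"
  then have bar: "bar x = x" and comm: "\<And>y. mul x y = mul y x"
    by (simp_all add: algebra_center_def commutator_def del: split_paired_All)
  obtain s b where x: "x = (s, b)" by (cases x)
  obtain r where r: "s = \<phi> r" using bar \<sigma>_fixed[of s] by (auto simp: x bar_eq)
  have "- \<theta> \<cdot> b = \<theta> \<cdot> b"
    using comm[of "(\<theta>, 0)"] by (simp add: x mul_eq linear_simps \<sigma>_\<theta>)
  then have "\<theta> \<cdot> b + \<theta> \<cdot> b = 0"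
    by (metis add.left_inverse scale_minus_left)
  then have "\<theta> \<cdot> b = 0" by (rule double_eq_0)
  then have "((\<phi> (inverse \<delta>) * \<theta>) * \<theta>) \<cdot> b = 0"
    by (simp only: scale_scale[symmetric] scale_zero_right)
  then have "b = 0" by (simp only: \<theta>_unit scale_one)
  then show "x \<in> range (\<lambda>x. KJ_scale \<phi> smul x (1, 0))"
    by (auto simp: x r KJ_scale_eq)
next
  fix x :: "'k \<times> 'j" assume "x \<in> range (\<lambda>x. KJ_scale \<phi> smul x (1, 0))"
  then obtain r where x: "x = KJ_scale \<phi> smul r (1, 0)" by blast
  show "x \<in> algebra_center mul bar"
    unfolding x algebra_center_def
    by (simp add: commutator_def associator_def KJ.bar_scale KJ.bar_one KJ.mul_scale_left KJ.mul_scale_right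
        KJ.mul_one_left KJ.mul_one_right)
qed

text \<open>The commutator with \<open>(\<theta>, 0)\<close> projects an ideal to its \<open>J\<close>-part. A scalar \<open>s \<noteq> 0\<close> in an ideal
  produces \<open>1\<close> by \<open>trace_eq_1\<close>, and a vector \<open>b \<noteq> 0\<close> produces the scalars \<open>T b c\<close>.\<close>

lemma KJ_simple:
  assumes "nondegenerate T"
  shows "simple_algebra (KJ_scale \<phi> smul) mul (bar :: 'k \<times> 'j \<Rightarrow> 'k \<times> 'j)"
  unfolding simple_algebra_def
proof (intro allI impI)
  fix I :: "('k \<times> 'j) set" assume "involution_ideal (KJ_scale \<phi> smul) mul bar I"
  then have I: "KJ.subspace I" and left: "\<And>x y. x \<in> I \<Longrightarrow> mul y x \<in> I"
    and right: "\<And>x y. x \<in> I \<Longrightarrow> mul x y \<in> I" and bar: "\<And>x. x \<in> I \<Longrightarrow> bar x \<in> I"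
    unfolding involution_ideal_def by auto
  have unit_scalar: "I = UNIV" if s: "(s, 0) \<in> I" "s \<noteq> 0" for s
  proof -
    obtain t where t: "t * s + \<sigma> (t * s) = 1" using trace_eq_1[OF s(2)] .
    have ts: "(t * s, 0) \<in> I"
      using left[OF s(1), of "(t, 0)"] by (simp add: mul_eq linear_simps)
    have "(t * s, 0) + bar (t * s, 0) \<in> I"
      by (rule KJ.subspace_add[OF I ts bar[OF ts]])
    then have "(1, 0) \<in> I" by (simp add: bar_eq t del: \<sigma>_mult)
    then show ?thesis using right[of "(1, 0)"] by (auto simp: KJ.mul_one_left)
  qed
  have vector_part: "(0, b) \<in> I" if x: "(s, b) \<in> I" for s b
  proof -
    define i where "i = \<phi> (inverse 2) * (\<phi> (inverse \<delta>) * \<theta>)"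
    have i: "i * (\<theta> + \<theta>) = 1"
      unfolding i_def by (rule two_\<theta>_unit)
    have "mul (\<theta>, 0) (s, b) - mul (s, b) (\<theta>, 0) \<in> I"
      by (rule KJ.subspace_diff[OF I left[OF x] right[OF x]])
    moreover have "mul (\<theta>, 0) (s, b) - mul (s, b) (\<theta>, 0) = (0, \<theta> \<cdot> b + \<theta> \<cdot> b)"
      by (simp add: mul_eq linear_simps \<sigma>_\<theta> mult.commute)
    moreover have "\<theta> \<cdot> b + \<theta> \<cdot> b = (\<theta> + \<theta>) \<cdot> b"
      by (simp only: scale_left_distrib)
    ultimately have "mul (i, 0) (0, (\<theta> + \<theta>) \<cdot> b) \<in> I"
      using left by simp
    moreover have "mul (i, 0) (0, (\<theta> + \<theta>) \<cdot> b) = (0, (i * (\<theta> + \<theta>)) \<cdot> b)"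
      by (simp add: mul_eq T_zero cross_zero \<sigma>_zero)
    ultimately show ?thesis by (simp only: i scale_one)
  qed
  have scalar_part: "(s, 0) \<in> I" if x: "(s, b) \<in> I" for s b
    using KJ.subspace_diff[OF I x vector_part[OF x]] by simp
  show "I = {0} \<or> I = UNIV"
  proof (rule disjCI)
    assume "I \<noteq> UNIV"
    have "x = 0" if x: "x \<in> I" for x
    proof -
      obtain s b where sb: "x = (s, b)" by (cases x)
      have "s = 0"
        using unit_scalar[OF scalar_part] x \<open>I \<noteq> UNIV\<close> unfolding sb by blast
      moreover have "T b c = 0" for c
      proof -
        have "mul (0, b) (0, c) \<in> I"
          using x unfolding sb by (intro right vector_part)
        then have "(T b c, b \<boxtimes> c) \<in> I" by (simp add: mul_eq linear_simps)
        then show ?thesis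
          using unit_scalar[OF scalar_part] \<open>I \<noteq> UNIV\<close> by blast
      qed
      then have "b = 0" using assms unfolding nondegenerate_def by blast
      ultimately show ?thesis by (simp add: sb zero_prod_def)
    qed
    then show "I = {0}" using KJ.subspace_0[OF I] by blast
  qed
qed

end

theorem corollary4p9:
  fixes \<phi> :: "'f::field \<Rightarrow> 'k::comm_ring_1"
    and \<sigma> :: "'k \<Rightarrow> 'k"
    and smul :: "'k \<Rightarrow> 'j::ab_group_add \<Rightarrow> 'j"
    and N :: "'j \<Rightarrow> 'k"
    and sharp :: "'j \<Rightarrow> 'j"
    and T :: "'j \<Rightarrow> 'j \<Rightarrow> 'k"
  assumes "CHAR('f) \<noteq> 2" and "CHAR('f) \<noteq> 3"
    and "quadratic_etale_extension \<phi> \<sigma>"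
    and "hermitian_cubic_norm_structure \<sigma> smul N sharp T"
    and "\<not> nondegenerate T \<Longrightarrow> quadratic_map (\<lambda>x. smul (\<phi> x)) sharp"
  shows "structurable_algebra (KJ_scale \<phi> smul) (KJ_mul \<sigma> smul sharp T) (1, 0) (KJ_bar \<sigma>) \<and>
         skew_dimension (KJ_scale \<phi> smul) (KJ_bar \<sigma> :: 'k \<times> 'j \<Rightarrow> 'k \<times> 'j) = 1 \<and>
         (nondegenerate T \<longrightarrow>
            central_algebra (KJ_scale \<phi> smul) (KJ_mul \<sigma> smul sharp T) (1, 0) (KJ_bar \<sigma>) \<and>
            simple_algebra (KJ_scale \<phi> smul) (KJ_mul \<sigma> smul sharp T) (KJ_bar \<sigma>))"
proof -
  have nonzero: "of_nat p \<noteq> (0 :: 'f)" if "prime p" "CHAR('f) \<noteq> p" for p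
    using that by (auto simp: of_nat_eq_0_iff_char_dvd prime_nat_iff)
  have two: "(2 :: 'f) \<noteq> 0" and three: "(3 :: 'f) \<noteq> 0"
    using nonzero[of 2] nonzero[of 3] assms(1,2) by simp_all
  obtain \<theta> \<delta> where "quadratic_conjugation \<phi> \<sigma> \<theta> \<delta>"
    using assms(3) split_quadratic_conjugation[OF two] field_quadratic_conjugation[OF two]
    unfolding quadratic_etale_extension_def by blast
  then interpret cubic_norm_over \<phi> \<sigma> \<theta> \<delta> smul N sharp T
    using three assms(4,5) by (intro cubic_norm_over.intro cubic_norm_over_axioms.intro)
  show ?thesis
    unfolding KJ_mul_eq KJ_bar_eq
    using KJ_structurable KJ_skew_dimension KJ_central KJ_simple by blast
qed

end
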